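(* Let $X$ and $Y$ be nonempty compact metric spaces and let $p_1\colon X\times Y\to X$ be the projection onto the first factor. Then the map $I(p_1)\colon I(X\times Y)\to I(X)$ is soft.
   Context: All maps are continuous. For a compact Hausdorff space $X$, $C(X)$ denotes the set of continuous functions $X\to\mathbb R$, and $c_X\in C(X)$ is the constant function with value $c\in\mathbb R$. For $c\in\mathbb R$ and $\varphi,\psi\in C(X)$ put $c\odot\varphi=c_X+\varphi$ and $\varphi\oplus\psi=\max\{\varphi,\psi\}$ (pointwise); for real numbers $a,b$ put $a\odot b=a+b$, $a\oplus b=\max\{a,b\}$. A functional $\mu\colon C(X)\to\mathbb R$ (not assumed linear) is an idempotent probability measure if $\mu(c_X)=c$, $\mu(c\odot\varphi)=c\odot\mu(\varphi)$ and $\mu(\varphi\oplus\psi)=\mu(\varphi)\oplus\mu(\psi)$ for all $c\in\mathbb R$, $\varphi,\psi\in C(X)$. $I(X)$ is the set of all idempotent probability measures on $X$ with the weak* topology, whose basis consists of the sets $\{\nu\in I(X): |\mu(\varphi_i)-\nu(\varphi_i)|<\varepsilon,\ i=1,\dots,n\}$, where $\mu\in I(X)$, $\varphi_1,\dots,\varphi_n\in C(X)$, $\varepsilon>0$. For a map $f\colon X\to Y$ of compact Hausdorff spaces, $I(f)\colon I(X)\to I(Y)$ is the continuous map $I(f)(\mu)(\varphi)=\mu(\varphi\circ f)$, $\varphi\in C(Y)$. A map $f\colon E\to B$ is soft if for every paracompact (Hausdorff) space $Z$, every closed subset $A\subset Z$, and all maps $\varphi\colon A\to E$ and $\psi\colon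 Z\to B$ with $f\circ\varphi=\psi|_A$, there exists a map $\Phi\colon Z\to E$ such that $f\circ\Phi=\psi$ and $\Phi|_A=\varphi$. *)

theory Defs
  imports "HOL-Analysis.Analysis"
begin

text \<open>Spaces are abstract topologies. Elements of the function spaces below are
  extensional, i.e. they take the dummy value \<^const>\<open>undefined\<close> off their domain, so that
  equality in HOL is equality of functions on the carrier.\<close>

definition cfun :: "'a topology \<Rightarrow> ('a \<Rightarrow> real) set"
  where "cfun X = {\<phi>. continuous_map X euclideanreal \<phi>} \<inter> extensional (topspace X)"

definition const_fun :: "'a topology \<Rightarrow> real \<Rightarrow> 'a \<Rightarrow> real"
  where "const_fun X c = (\<lambda>x\<in>topspace X. c)"

definition shift_fun :: "'a topology \<Rightarrow> real \<Rightarrow> ('a \<Rightarrow> real) \<Rightarrow> 'a \<Rightarrow> real"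
  where "shift_fun X c \<phi> = (\<lambda>x\<in>topspace X. c + \<phi> x)"

definition max_fun :: "'a topology \<Rightarrow> ('a \<Rightarrow> real) \<Rightarrow> ('a \<Rightarrow> real) \<Rightarrow> 'a \<Rightarrow> real"
  where "max_fun X \<phi> \<psi> = (\<lambda>x\<in>topspace X. max (\<phi> x) (\<psi> x))"

definition idem_measures :: "'a topology \<Rightarrow> (('a \<Rightarrow> real) \<Rightarrow> real) set"
  where "idem_measures X =
    {\<mu> \<in> extensional (cfun X).
       (\<forall>c. \<mu> (const_fun X c) = c) \<and>
       (\<forall>c. \<forall>\<phi>\<in>cfun X. \<mu> (shift_fun X c \<phi>) = c + \<mu> \<phi>) \<and>
       (\<forall>\<phi>\<in>cfun X. \<forall>\<psi>\<in>cfun X. \<mu> (max_fun X \<phi> \<psi>) = max (\<mu> \<phi>) (\<mu> \<psi>))}"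

definition weak_nhd ::
  "'a topology \<Rightarrow> (('a \<Rightarrow> real) \<Rightarrow> real) \<Rightarrow> ('a \<Rightarrow> real) set \<Rightarrow> real \<Rightarrow> (('a \<Rightarrow> real) \<Rightarrow> real) set"
  where "weak_nhd X \<mu> F \<epsilon> = {\<nu> \<in> idem_measures X. \<forall>\<phi>\<in>F. \<bar>\<mu> \<phi> - \<nu> \<phi>\<bar> < \<epsilon>}"

text \<open>The generating sets are in fact a base: see \<open>openin_idem_space\<close> below.\<close>

definition idem_space :: "'a topology \<Rightarrow> (('a \<Rightarrow> real) \<Rightarrow> real) topology"
  where "idem_space X = topology_generated_by
    {weak_nhd X \<mu> F \<epsilon> | \<mu> F \<epsilon>. \<mu> \<in> idem_measures X \<and> finite F \<and> F \<subseteq> cfun X \<and> \<epsilon> > 0}"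

definition idem_map ::
  "'a topology \<Rightarrow> 'b topology \<Rightarrow> ('a \<Rightarrow> 'b) \<Rightarrow> (('a \<Rightarrow> real) \<Rightarrow> real) \<Rightarrow> ('b \<Rightarrow> real) \<Rightarrow> real"
  where "idem_map X Y f \<mu> = (\<lambda>\<phi>\<in>cfun Y. \<mu> (restrict (\<phi> \<circ> f) (topspace X)))"

definition paracompact_space :: "'a topology \<Rightarrow> bool"
  where "paracompact_space Z \<longleftrightarrow>
    (\<forall>\<U>. (\<forall>U\<in>\<U>. openin Z U) \<and> \<Union>\<U> = topspace Z \<longrightarrow>
      (\<exists>\<V>. (\<forall>V\<in>\<V>. openin Z V) \<and> \<Union>\<V> = topspace Z \<and>
           (\<forall>V\<in>\<V>. \<exists>U\<in>\<U>. V \<subseteq> U) \<and> locally_finite_in Z \<V>))"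

text \<open>HOL definitions cannot quantify over types, so the point type of the test spaces
  \<open>Z\<close> is a parameter. Softness is the statement for an arbitrary type \<open>'z\<close>, i.e. with
  \<open>'z\<close> a free type variable of the theorem.\<close>

definition soft_map ::
  "'z itself \<Rightarrow> 'e topology \<Rightarrow> 'b topology \<Rightarrow> ('e \<Rightarrow> 'b) \<Rightarrow> bool"
  where "soft_map (_ :: 'z itself) E B f \<longleftrightarrow>
    continuous_map E B f \<and>
    (\<forall>(Z :: 'z topology) A \<phi> \<psi>.
       paracompact_space Z \<and> Hausdorff_space Z \<and> closedin Z A \<and>
       continuous_map (subtopology Z A) E \<phi> \<and> continuous_map Z B \<psi> \<and>
       (\<forall>z\<in>A. f (\<phi> z) = \<psi> z) \<longrightarrow>
       (\<exists>\<Phi>. continuous_map Z E \<Phi> \<and>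
            (\<forall>z\<in>topspace Z. f (\<Phi> z) = \<psi> z) \<and> (\<forall>z\<in>A. \<Phi> z = \<phi> z)))"

lemma weak_nhd_shrink:
  assumes "finite F" "\<nu> \<in> weak_nhd X \<mu> F \<epsilon>"
  shows "\<exists>\<delta>>0. weak_nhd X \<nu> F \<delta> \<subseteq> weak_nhd X \<mu> F \<epsilon>"
proof -
  define \<delta> where "\<delta> = Min (insert 1 ((\<lambda>\<phi>. \<epsilon> - \<bar>\<mu> \<phi> - \<nu> \<phi>\<bar>) ` F))"
  have "\<delta> > 0"
    using assms by (auto simp: \<delta>_def weak_nhd_def)
  moreover have "\<delta> \<le> \<epsilon> - \<bar>\<mu> \<phi> - \<nu> \<phi>\<bar>" if "\<phi> \<in> F" for \<phi>
    unfolding \<delta>_def using that assms(1) by (intro Min_le) auto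
  then have "weak_nhd X \<nu> F \<delta> \<subseteq> weak_nhd X \<mu> F \<epsilon>"
    unfolding weak_nhd_def by fastforce
  ultimately show ?thesis by blast
qed

lemma openin_idem_space:
  "openin (idem_space X) W \<longleftrightarrow>
     W \<subseteq> idem_measures X \<and>
     (\<forall>\<mu>\<in>W. \<exists>F \<epsilon>. finite F \<and> F \<subseteq> cfun X \<and> \<epsilon> > 0 \<and> weak_nhd X \<mu> F \<epsilon> \<subseteq> W)"
    (is "_ \<longleftrightarrow> ?R W")
proof
  let ?S = "{weak_nhd X \<mu> F \<epsilon> | \<mu> F \<epsilon>.
    \<mu> \<in> idem_measures X \<and> finite F \<and> F \<subseteq> cfun X \<and> \<epsilon> > 0}"
  assume "openin (idem_space X) W"
  then have "generate_topology_on ?S W"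
    by (simp add: idem_space_def openin_topology_generated_by)
  then show "?R W"
  proof (induction rule: generate_topology_on.induct)
    case Empty
    then show ?case by simp
  next
    case (Int U V)
    have "\<exists>F \<epsilon>. finite F \<and> F \<subseteq> cfun X \<and> \<epsilon> > 0 \<and> weak_nhd X \<mu> F \<epsilon> \<subseteq> U \<inter> V"
      if \<mu>: "\<mu> \<in> U \<inter> V" for \<mu>
    proof -
      obtain F \<epsilon> where 1: "finite F" "F \<subseteq> cfun X" "\<epsilon> > 0" "weak_nhd X \<mu> F \<epsilon> \<subseteq> U"
        using Int \<mu> by blast
      obtain G \<delta> where 2: "finite G" "G \<subseteq> cfun X" "\<delta> > 0" "weak_nhd X \<mu> G \<delta> \<subseteq> V"
        using Int \<mu> by blast
      have "weak_nhd X \<mu> (F \<union> G) (min \<epsilon> \<delta>) \<subseteq> weak_nhd X \<mu> F \<epsilon> \<inter> weak_nhd X \<mu> G \<delta>"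
        by (auto simp: weak_nhd_def)
      with 1 2 show ?thesis
        by (intro exI[of _ "F \<union> G"] exI[of _ "min \<epsilon> \<delta>"]) auto
    qed
    with Int show ?case by blast
  next
    case (UN K)
    have "\<exists>F \<epsilon>. finite F \<and> F \<subseteq> cfun X \<and> \<epsilon> > 0 \<and> weak_nhd X \<mu> F \<epsilon> \<subseteq> \<Union>K"
      if \<mu>: "\<mu> \<in> \<Union>K" for \<mu>
    proof -
      obtain k where k: "k \<in> K" "\<mu> \<in> k" using \<mu> by blast
      then obtain F \<epsilon> where "finite F" "F \<subseteq> cfun X" "\<epsilon> > 0" "weak_nhd X \<mu> F \<epsilon> \<subseteq> k"
        using UN by metis
      with k show ?thesis by (metis Union_upper subset_trans)
    qed
    moreover have "\<Union>K \<subseteq> idem_measures X" using UN by blast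
    ultimately show ?case by blast
  next
    case (Basis U)
    then obtain \<mu> F \<epsilon> where U: "U = weak_nhd X \<mu> F \<epsilon>" "finite F" "F \<subseteq> cfun X"
      by blast
    have "U \<subseteq> idem_measures X" by (auto simp: U weak_nhd_def)
    moreover have "\<exists>F \<epsilon>. finite F \<and> F \<subseteq> cfun X \<and> \<epsilon> > 0 \<and> weak_nhd X \<nu> F \<epsilon> \<subseteq> U"
      if "\<nu> \<in> U" for \<nu>
      using weak_nhd_shrink[of F \<nu> X \<mu> \<epsilon>] that U by blast
    ultimately show ?case by blast
  qed
next
  assume R: "?R W"
  have "\<exists>T. openin (idem_space X) T \<and> \<mu> \<in> T \<and> T \<subseteq> W" if \<mu>: "\<mu> \<in> W" for \<mu>
  proof -
    obtain F \<epsilon> where F: "finite F" "F \<subseteq> cfun X" "\<epsilon> > 0" "weak_nhd X \<mu> F \<epsilon> \<subseteq> W"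
      using R \<mu> by blast
    have "\<mu> \<in> idem_measures X" using R \<mu> by blast
    then have "openin (idem_space X) (weak_nhd X \<mu> F \<epsilon>)"
      unfolding idem_space_def using F by (intro topology_generated_by_Basis) blast
    moreover have "\<mu> \<in> weak_nhd X \<mu> F \<epsilon>"
      using F \<open>\<mu> \<in> idem_measures X\<close> by (simp add: weak_nhd_def)
    ultimately show ?thesis using F by blast
  qed
  then show "openin (idem_space X) W"
    by (subst openin_subopen) blast
qed

lemma topspace_idem_space [simp]: "topspace (idem_space X) = idem_measures X"
proof
  show "topspace (idem_space X) \<subseteq> idem_measures X"
    using openin_idem_space[of X] openin_topspace by blast
  have "openin (idem_space X) (idem_measures X)"
    unfolding openin_idem_space
    by (auto simp: weak_nhd_def intro!: exI[of _ "{}"] exI[of _ "1::real"])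
  then show "idem_measures X \<subseteq> topspace (idem_space X)"
    by (rule openin_subset)
qed

end

theory Submission
  imports Defs
begin

text \<open>
  Heuristically an idempotent measure \<open>\<mu>\<close> on \<open>X \<times> Y\<close> has an upper semicontinuous density \<open>\<lambda> \<le> 0\<close>
  with \<open>\<mu> f = max (f + \<lambda>)\<close>, and its marginal \<open>\<nu>\<close> has density \<open>\<kappa> x = max\<^sub>y \<lambda> (x, y)\<close>. The key
  remark is that measures with a prescribed marginal are easy to write down: whatever the
  continuous function \<open>k\<close> on \<open>X \<times> Y\<close> is, the density
  \<open>\<kappa> x + k (x, y) - max\<^sub>y k (x, y)\<close> has marginal \<open>\<nu>\<close>. As a functional it is \<open>\<nu> \<circ> T\<^sub>k\<close> with
  \<open>T\<^sub>k f x = max\<^sub>y (f + k) - max\<^sub>y k\<close> (\<open>lift_fun\<close>), which depends continuously on \<open>\<nu>\<close> and \<open>k\<close>.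
  So the task is to find kernels \<open>k\<close> for which \<open>\<nu> \<circ> T\<^sub>k\<close> is close to \<open>\<mu>\<close>.

  The choice \<open>k = \<lambda>\<close> is not continuous. It can be replaced by the Lipschitz regularization
  \<open>\<lambda>\<^sub>s w = max\<^sub>v (\<lambda> v - s d(v, w))\<close>, which is the value of \<open>\<mu>\<close> on the cone \<open>- s d(\<cdot>, w)\<close>. But
  \<open>k = \<lambda>\<^sub>s\<close> does not work uniformly in \<open>\<mu>\<close>: where \<open>\<kappa>\<close> jumps by a large amount within a distance of
  order \<open>1 / s\<close>, subtracting \<open>max\<^sub>y \<lambda>\<^sub>s\<close> costs an amount that does not tend to \<open>0\<close>. Two scales
  cure this: take \<open>k = min \<lambda>\<^sub>s \<kappa>\<^sub>S\<close>, where \<open>\<kappa>\<^sub>S\<close> is the regularization of \<open>\<kappa>\<close> at a scale \<open>S\<close> that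
  is much finer than \<open>s\<close>. Then \<open>max\<^sub>y k\<close> is essentially \<open>\<kappa>\<^sub>S\<close>, every point at which \<open>\<kappa>\<close> is
  not too small lies at a distance \<open>O(1 / S)\<close> from one at which \<open>\<kappa> = \<kappa>\<^sub>S\<close>, and moving to the
  latter costs only \<open>O(s / S)\<close> in \<open>\<lambda>\<^sub>s\<close>.
  The two-sided estimate is \<open>two_scales.abs_ev_lift_fun_diff_le\<close>. It speaks of values of \<open>\<mu>\<close> on cones
  instead of densities; what replaces the choice of a maximizing point is \<open>ev_dominated\<close>: if a
  function is dominated pointwise by a finite family then its value is dominated by the value of
  one member of the family.

  By compactness a finite net of cone vertices suffices. So, given \<open>\<phi>\<close> on \<open>A\<close> and \<open>\<psi>\<close> on \<open>Z\<close>, the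
  kernel at \<open>z \<in> A\<close> depends only on finitely many real numbers: values of \<open>\<phi> z\<close>, which extend
  continuously to \<open>Z\<close> by Tietze's theorem, and values of \<open>\<psi> z\<close>, which are defined on \<open>Z\<close> already. This
  gives maps on \<open>Z\<close> that have marginal \<open>\<psi>\<close> exactly and agree with \<open>\<phi>\<close> on \<open>A\<close> up to a prescribed error on
  finitely many test functions (\<open>ex_approximate_lift\<close>).

  Finally, the set of measures with a given marginal is convex in the max-plus sense. So a
  Urysohn function can blend two approximate lifts into one that coincides on \<open>A\<close> with the better
  of the two and stays uniformly close to the other one (\<open>ex_refined_lift\<close>). Iterating
  gives a uniformly Cauchy sequence of lifts whose limit restricts to \<open>\<phi>\<close> on \<open>A\<close>
  (\<open>ex_lift_of_approximate_lifts\<close>); countably many steps are enough because an idempotent measure on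
  a compact metric space is determined by a sequence of cones (\<open>ex_determining\<close>). Tietze's and
  Urysohn's theorems apply because paracompact Hausdorff spaces are normal.
\<close>

section \<open>Paracompact Hausdorff spaces are normal\<close>

text \<open>Cover \<open>A\<close> by the sets whose closures miss \<open>B\<close> and refine the cover to a locally finite one:
  closures commute with locally finite unions. With \<open>B\<close> a point this gives regularity from the
  Hausdorff property, and applied once more it gives normality from regularity.\<close>

lemma paracompact_separation:
  assumes Z: "paracompact_space Z" and A: "closedin Z A" and B: "B \<subseteq> topspace Z"
    and sep: "\<And>a. a \<in> A \<Longrightarrow> \<exists>U V. openin Z U \<and> openin Z V \<and> a \<in> U \<and> B \<subseteq> V \<and> disjnt U V"
  shows "\<exists>U V. openin Z U \<and> openin Z V \<and> A \<subseteq> U \<and> B \<subseteq> V \<and> disjnt U V"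
proof -
  define \<U> where "\<U> = {U. openin Z U \<and> (\<exists>V. openin Z V \<and> B \<subseteq> V \<and> disjnt U V)}"
  have cov: "\<Union>(insert (topspace Z - A) \<U>) = topspace Z"
  proof
    show "\<Union>(insert (topspace Z - A) \<U>) \<subseteq> topspace Z"
      unfolding \<U>_def using openin_subset by blast
    show "topspace Z \<subseteq> \<Union>(insert (topspace Z - A) \<U>)"
      unfolding \<U>_def using sep by fastforce
  qed
  have op: "\<forall>U \<in> insert (topspace Z - A) \<U>. openin Z U"
    using A by (auto simp: \<U>_def)
  obtain \<V> where \<V>: "\<forall>V\<in>\<V>. openin Z V" "\<Union>\<V> = topspace Z"
      "\<forall>V\<in>\<V>. \<exists>U\<in>insert (topspace Z - A) \<U>. V \<subseteq> U" "locally_finite_in Z \<V>"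
    using Z[unfolded paracompact_space_def, rule_format, of "insert (topspace Z - A) \<U>"] cov op
    by blast
  define \<W> where "\<W> = {V \<in> \<V>. V \<inter> A \<noteq> {}}"
  have lf: "locally_finite_in Z \<W>"
    using \<V>(4) by (rule locally_finite_in_subset) (auto simp: \<W>_def)
  have "disjnt (Z closure_of W) B" if W: "W \<in> \<W>" for W
  proof -
    obtain U where "U \<in> \<U>" "W \<subseteq> U"
      using \<V>(3) W unfolding \<W>_def by blast
    then obtain V where V: "openin Z V" "B \<subseteq> V" "disjnt W V"
      unfolding \<U>_def disjnt_def by blast
    then have "V \<inter> Z closure_of W = {}"
      using openin_Int_closure_of_eq_empty[of Z V W] by (auto simp: disjnt_def)
    with V show ?thesis
      by (auto simp: disjnt_def)
  qed
  then have "disjnt (Z closure_of (\<Union>\<W>)) B"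
    unfolding closure_of_locally_finite_Union[OF lf] by (auto simp: disjnt_def)
  then have "B \<subseteq> topspace Z - Z closure_of (\<Union>\<W>)"
    using B by (auto simp: disjnt_def)
  moreover have "A \<subseteq> \<Union>\<W>"
    using closedin_subset[OF A] \<V>(2) unfolding \<W>_def by blast
  moreover have "openin Z (\<Union>\<W>)"
    using \<V>(1) by (intro openin_Union) (auto simp: \<W>_def)
  moreover have "disjnt (\<Union>\<W>) (topspace Z - Z closure_of (\<Union>\<W>))"
    using closure_of_subset[OF openin_subset[OF \<open>openin Z (\<Union>\<W>)\<close>]] by (auto simp: disjnt_def)
  ultimately show ?thesis
    by (meson closedin_closure_of closedin_def)
qed

lemma paracompact_Hausdorff_imp_normal_space:
  assumes Z: "paracompact_space Z" and H: "Hausdorff_space Z"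
  shows "normal_space Z"
proof -
  have regular: "\<exists>U V. openin Z U \<and> openin Z V \<and> A \<subseteq> U \<and> {b} \<subseteq> V \<and> disjnt U V"
    if "closedin Z A" "b \<in> topspace Z - A" for A b
  proof (rule paracompact_separation[OF Z that(1)])
    show "\<exists>U V. openin Z U \<and> openin Z V \<and> a \<in> U \<and> {b} \<subseteq> V \<and> disjnt U V" if "a \<in> A" for a
      using H \<open>b \<in> topspace Z - A\<close> that closedin_subset[OF \<open>closedin Z A\<close>]
      unfolding Hausdorff_space_def by (metis DiffE empty_subsetI insert_subset subsetD)
  qed (use that in auto)
  show ?thesis
    unfolding normal_space_def
  proof (intro allI impI)
    fix A B
    assume AB: "closedin Z A \<and> closedin Z B \<and> disjnt A B"
    show "\<exists>U V. openin Z U \<and> openin Z V \<and> A \<subseteq> U \<and> B \<subseteq> V \<and> disjnt U V"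
    proof (rule paracompact_separation[OF Z])
      fix a assume "a \<in> A"
      then have "a \<in> topspace Z - B"
        using AB closedin_subset[of Z A] by (auto simp: disjnt_def)
      then show "\<exists>U V. openin Z U \<and> openin Z V \<and> a \<in> U \<and> B \<subseteq> V \<and> disjnt U V"
        using regular[of B a] AB by (metis disjnt_sym insert_subset)
    qed (use AB closedin_subset in auto)
  qed
qed

section \<open>Evaluation of idempotent measures\<close>

text \<open>Measures are defined on extensional functions only. \<open>ev X \<mu> h\<close> lets them act on an
  arbitrary function that is continuous on \<open>X\<close>, so that the algebra of functions can be done
  with plain lambda terms.\<close>

definition ev :: "'a topology \<Rightarrow> (('a \<Rightarrow> real) \<Rightarrow> real) \<Rightarrow> ('a \<Rightarrow> real) \<Rightarrow> real"
  where "ev X \<mu> h = \<mu> (restrict h (topspace X))"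

lemma restrict_in_cfun:
  "continuous_map X euclideanreal h \<Longrightarrow> restrict h (topspace X) \<in> cfun X"
  by (auto simp: cfun_def intro: continuous_map_eq)

lemma cfun_continuous: "f \<in> cfun X \<Longrightarrow> continuous_map X euclideanreal f"
  by (simp add: cfun_def)

lemma ev_cfun: "f \<in> cfun X \<Longrightarrow> ev X \<mu> f = \<mu> f"
  by (simp add: ev_def cfun_def extensional_restrict)

lemma ev_cong: "(\<And>x. x \<in> topspace X \<Longrightarrow> f x = g x) \<Longrightarrow> ev X \<mu> f = ev X \<mu> g"
  unfolding ev_def by (metis restrict_ext)

lemma ev_const: "\<mu> \<in> idem_measures X \<Longrightarrow> ev X \<mu> (\<lambda>x. c) = c"
  by (simp add: ev_def idem_measures_def const_fun_def)

lemma ev_add_const: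
  assumes "\<mu> \<in> idem_measures X" "continuous_map X euclideanreal h"
  shows "ev X \<mu> (\<lambda>x. c + h x) = c + ev X \<mu> h"
proof -
  have "\<mu> (shift_fun X c (restrict h (topspace X))) = c + \<mu> (restrict h (topspace X))"
    using assms(1) restrict_in_cfun[OF assms(2)] by (auto simp: idem_measures_def)
  moreover have "shift_fun X c (restrict h (topspace X)) = restrict (\<lambda>x. c + h x) (topspace X)"
    by (auto simp: shift_fun_def restrict_def)
  ultimately show ?thesis by (simp add: ev_def)
qed

lemma ev_max:
  assumes "\<mu> \<in> idem_measures X"
    "continuous_map X euclideanreal h" "continuous_map X euclideanreal g"
  shows "ev X \<mu> (\<lambda>x. max (h x) (g x)) = max (ev X \<mu> h) (ev X \<mu> g)"
proof -
  have "\<mu> (max_fun X (restrict h (topspace X)) (restrict g (topspace X))) =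
      max (\<mu> (restrict h (topspace X))) (\<mu> (restrict g (topspace X)))"
    using assms(1) restrict_in_cfun[OF assms(2)] restrict_in_cfun[OF assms(3)]
    by (auto simp: idem_measures_def)
  moreover have "max_fun X (restrict h (topspace X)) (restrict g (topspace X)) =
      restrict (\<lambda>x. max (h x) (g x)) (topspace X)"
    by (auto simp: max_fun_def restrict_def)
  ultimately show ?thesis by (simp add: ev_def)
qed

lemma ev_mono:
  assumes \<mu>: "\<mu> \<in> idem_measures X"
    and h: "continuous_map X euclideanreal h" and g: "continuous_map X euclideanreal g"
    and "\<And>x. x \<in> topspace X \<Longrightarrow> h x \<le> g x"
  shows "ev X \<mu> h \<le> ev X \<mu> g"
proof -
  have "ev X \<mu> g = ev X \<mu> (\<lambda>x. max (h x) (g x))"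
    using assms(4) by (intro ev_cong) (simp add: max_absorb2)
  also have "\<dots> = max (ev X \<mu> h) (ev X \<mu> g)"
    by (rule ev_max[OF \<mu> h g])
  finally show ?thesis by simp
qed

lemma ev_le_add:
  assumes \<mu>: "\<mu> \<in> idem_measures X"
    and h: "continuous_map X euclideanreal h" and g: "continuous_map X euclideanreal g"
    and "\<And>x. x \<in> topspace X \<Longrightarrow> h x \<le> c + g x"
  shows "ev X \<mu> h \<le> c + ev X \<mu> g"
proof -
  have "ev X \<mu> h \<le> ev X \<mu> (\<lambda>x. c + g x)"
    using assms by (intro ev_mono continuous_intros) auto
  with ev_add_const[OF \<mu> g] show ?thesis by simp
qed

lemma ev_nonexpansive:
  assumes \<mu>: "\<mu> \<in> idem_measures X"
    and h: "continuous_map X euclideanreal h" and g: "continuous_map X euclideanreal g"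
    and "\<And>x. x \<in> topspace X \<Longrightarrow> \<bar>h x - g x\<bar> \<le> c"
  shows "\<bar>ev X \<mu> h - ev X \<mu> g\<bar> \<le> c"
proof -
  have "h x \<le> c + g x" "g x \<le> c + h x" if "x \<in> topspace X" for x
    using assms(4)[OF that] by linarith+
  then have "ev X \<mu> h \<le> c + ev X \<mu> g" "ev X \<mu> g \<le> c + ev X \<mu> h"
    using ev_le_add[OF \<mu> h g] ev_le_add[OF \<mu> g h] by auto
  then show ?thesis by linarith
qed

text \<open>An idempotent measure commutes with finite maxima, and the maximum of finitely many
  numbers is one of them. This lemma takes the place of choosing a point at which a density
  attains its maximum.\<close>

lemma ev_dominated:
  assumes \<mu>: "\<mu> \<in> idem_measures X" and "finite G" "G \<noteq> {}"
    and "\<And>g. g \<in> G \<Longrightarrow> continuous_map X euclideanreal g"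
    and h: "continuous_map X euclideanreal h"
    and "\<And>x. x \<in> topspace X \<Longrightarrow> \<exists>g\<in>G. h x \<le> g x"
  shows "\<exists>g\<in>G. ev X \<mu> h \<le> ev X \<mu> g"
proof -
  have "\<exists>m. continuous_map X euclideanreal m \<and> (\<forall>x. \<forall>g\<in>G. g x \<le> m x) \<and>
      (\<exists>g\<in>G. ev X \<mu> m = ev X \<mu> g)"
    using assms(2-4)
  proof (induction rule: finite_ne_induct)
    case (singleton g)
    then show ?case by auto
  next
    case (insert g G)
    then obtain m where m: "continuous_map X euclideanreal m" "\<forall>x. \<forall>g\<in>G. g x \<le> m x"
      "\<exists>g\<in>G. ev X \<mu> m = ev X \<mu> g" by auto
    have "ev X \<mu> (\<lambda>x. max (g x) (m x)) = max (ev X \<mu> g) (ev X \<mu> m)"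
      using insert.prems m by (intro ev_max[OF \<mu>]) auto
    then have "\<exists>g'\<in>insert g G. ev X \<mu> (\<lambda>x. max (g x) (m x)) = ev X \<mu> g'"
      using m(3) by (metis insert_iff max_def)
    moreover have "continuous_map X euclideanreal (\<lambda>x. max (g x) (m x))"
      using insert.prems m(1) by (intro continuous_map_real_max) auto
    moreover have "\<forall>x. \<forall>g'\<in>insert g G. g' x \<le> max (g x) (m x)"
      using m(2) by (auto simp: le_max_iff_disj)
    ultimately show ?case by blast
  qed
  then obtain m g where m: "continuous_map X euclideanreal m" "\<forall>x. \<forall>g\<in>G. g x \<le> m x"
    "g \<in> G" "ev X \<mu> m = ev X \<mu> g" by auto
  have "ev X \<mu> h \<le> ev X \<mu> m"
    using m(2) assms(6) by (intro ev_mono[OF \<mu> h m(1)]) (meson order_trans)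
  with m show ?thesis by auto
qed

lemma idem_measures_eqI:
  assumes "\<mu> \<in> idem_measures X" "\<nu> \<in> idem_measures X"
    and "\<And>f. f \<in> cfun X \<Longrightarrow> \<mu> f = \<nu> f"
  shows "\<mu> = \<nu>"
  using assms by (intro extensionalityI[of _ "cfun X"]) (auto simp: idem_measures_def)

lemma ev_restrict:
  assumes "\<And>f g. (\<And>x. x \<in> topspace X \<Longrightarrow> f x = g x) \<Longrightarrow> J f = J g"
    and "continuous_map X euclideanreal h"
  shows "ev X (restrict J (cfun X)) h = J h"
  using restrict_in_cfun[OF assms(2)] assms(1)[of "restrict h (topspace X)" h] by (simp add: ev_def)

text \<open>Measures are constructed below from functionals \<open>J\<close> that are defined on all functions
  but only look at the restriction to \<open>X\<close>; the axioms can then be checked without extensional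
  functions.\<close>

lemma restrict_in_idem_measures:
  assumes cong: "\<And>f g. (\<And>x. x \<in> topspace X \<Longrightarrow> f x = g x) \<Longrightarrow> J f = J g"
    and const: "\<And>c. J (\<lambda>x. c) = c"
    and add: "\<And>c f. continuous_map X euclideanreal f \<Longrightarrow> J (\<lambda>x. c + f x) = c + J f"
    and max: "\<And>f g. continuous_map X euclideanreal f \<Longrightarrow> continuous_map X euclideanreal g \<Longrightarrow>
      J (\<lambda>x. max (f x) (g x)) = max (J f) (J g)"
  shows "restrict J (cfun X) \<in> idem_measures X"
proof -
  have "const_fun X c \<in> cfun X" for c
    unfolding const_fun_def by (intro restrict_in_cfun) auto
  moreover have "J (const_fun X c) = c" for c
    using cong[of "const_fun X c" "\<lambda>x. c"] const[of c] by (simp add: const_fun_def)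
  moreover have "shift_fun X c f \<in> cfun X" if "f \<in> cfun X" for c f
    unfolding shift_fun_def using that
    by (intro restrict_in_cfun continuous_intros) (auto simp: cfun_def)
  moreover have "J (shift_fun X c f) = c + J f" if "f \<in> cfun X" for c f
    using cong[of "shift_fun X c f" "\<lambda>x. c + f x"] add[of f c] that
    by (simp add: shift_fun_def cfun_def)
  moreover have "max_fun X f g \<in> cfun X" if "f \<in> cfun X" "g \<in> cfun X" for f g
    unfolding max_fun_def using that
    by (intro restrict_in_cfun continuous_intros) (auto simp: cfun_def)
  moreover have "J (max_fun X f g) = Orderings.max (J f) (J g)"
    if "f \<in> cfun X" "g \<in> cfun X" for f g
    using cong[of "max_fun X f g" "\<lambda>x. Orderings.max (f x) (g x)"] max[of f g] that
    by (simp add: max_fun_def cfun_def)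
  ultimately show ?thesis
    by (simp add: idem_measures_def)
qed

lemma ev_idem_map:
  assumes "continuous_map X Y f" "continuous_map Y euclideanreal g"
  shows "ev Y (idem_map X Y f \<mu>) g = ev X \<mu> (\<lambda>x. g (f x))"
proof -
  have "restrict (restrict g (topspace Y) \<circ> f) (topspace X) = restrict (\<lambda>x. g (f x)) (topspace X)"
    using continuous_map_image_subset_topspace[OF assms(1)] by (intro ext) auto
  then show ?thesis
    using restrict_in_cfun[OF assms(2)] by (simp add: ev_def idem_map_def)
qed

lemma idem_map_in_idem_measures:
  assumes \<mu>: "\<mu> \<in> idem_measures X" and f: "continuous_map X Y f"
  shows "idem_map X Y f \<mu> \<in> idem_measures Y"
proof -
  have im: "f x \<in> topspace Y" if "x \<in> topspace X" for x
    using continuous_map_image_subset_topspace[OF f] that by auto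
  have cont: "continuous_map X euclideanreal (\<lambda>x. g (f x))"
    if "continuous_map Y euclideanreal g" for g
    using continuous_map_compose[OF f that] by (simp add: o_def)
  have "idem_map X Y f \<mu> = restrict (\<lambda>g. ev X \<mu> (\<lambda>x. g (f x))) (cfun Y)"
    by (simp add: idem_map_def ev_def o_def)
  also have "\<dots> \<in> idem_measures Y"
    using im cont \<mu>
    by (intro restrict_in_idem_measures ev_cong) (auto simp: ev_const ev_add_const ev_max)
  finally show ?thesis .
qed

section \<open>Continuity of maps into the space of idempotent measures\<close>

text \<open>The weak* topology is the topology of pointwise convergence on \<open>C(X)\<close>.\<close>

lemma continuous_map_idem_space:
  "continuous_map Z (idem_space X) \<Psi> \<longleftrightarrow>
     (\<forall>z\<in>topspace Z. \<Psi> z \<in> idem_measures X) \<and>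
     (\<forall>f\<in>cfun X. continuous_map Z euclideanreal (\<lambda>z. \<Psi> z f))"
proof
  assume \<Psi>: "continuous_map Z (idem_space X) \<Psi>"
  have ev: "continuous_map (idem_space X) euclideanreal (\<lambda>\<mu>. \<mu> f)" if f: "f \<in> cfun X" for f
  proof -
    have "openin (idem_space X) {\<mu> \<in> idem_measures X. \<mu> f \<in> U}" if U: "open U" for U
      unfolding openin_idem_space
    proof (intro conjI ballI)
      fix \<mu> assume \<mu>: "\<mu> \<in> {\<mu> \<in> idem_measures X. \<mu> f \<in> U}"
      then obtain e where e: "e > 0" "\<forall>t. dist t (\<mu> f) < e \<longrightarrow> t \<in> U"
        using U unfolding open_dist by auto
      then have "weak_nhd X \<mu> {f} e \<subseteq> {\<mu> \<in> idem_measures X. \<mu> f \<in> U}"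
        by (auto simp: weak_nhd_def dist_real_def abs_minus_commute)
      then show "\<exists>F \<epsilon>. finite F \<and> F \<subseteq> cfun X \<and> \<epsilon> > 0 \<and>
          weak_nhd X \<mu> F \<epsilon> \<subseteq> {\<mu> \<in> idem_measures X. \<mu> f \<in> U}"
        using f e(1) by blast
    qed auto
    then show ?thesis
      by (auto simp: continuous_map_def)
  qed
  show "(\<forall>z\<in>topspace Z. \<Psi> z \<in> idem_measures X) \<and>
     (\<forall>f\<in>cfun X. continuous_map Z euclideanreal (\<lambda>z. \<Psi> z f))"
    using continuous_map_image_subset_topspace[OF \<Psi>] continuous_map_compose[OF \<Psi> ev]
    by (auto simp: o_def)
next
  assume R: "(\<forall>z\<in>topspace Z. \<Psi> z \<in> idem_measures X) \<and>
     (\<forall>f\<in>cfun X. continuous_map Z euclideanreal (\<lambda>z. \<Psi> z f))"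
  show "continuous_map Z (idem_space X) \<Psi>"
    unfolding idem_space_def
  proof (rule continuous_on_generated_topo)
    show "\<Psi> ` topspace Z \<subseteq>
        \<Union>{weak_nhd X \<mu> F \<epsilon> |\<mu> F \<epsilon>. \<mu> \<in> idem_measures X \<and> finite F \<and> F \<subseteq> cfun X \<and> \<epsilon> > 0}"
    proof
      fix \<nu> assume "\<nu> \<in> \<Psi> ` topspace Z"
      then have "\<nu> \<in> idem_measures X" using R by auto
      then have "\<nu> \<in> weak_nhd X \<nu> {} 1" by (simp add: weak_nhd_def)
      with \<open>\<nu> \<in> idem_measures X\<close>
      show "\<nu> \<in> \<Union>{weak_nhd X \<mu> F \<epsilon> |\<mu> F \<epsilon>.
          \<mu> \<in> idem_measures X \<and> finite F \<and> F \<subseteq> cfun X \<and> \<epsilon> > 0}"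
        by (intro UnionI[of "weak_nhd X \<nu> {} 1"] CollectI exI conjI) auto
    qed
  next
    fix U
    assume "U \<in> {weak_nhd X \<mu> F \<epsilon> |\<mu> F \<epsilon>. \<mu> \<in> idem_measures X \<and> finite F \<and> F \<subseteq> cfun X \<and> \<epsilon> > 0}"
    then obtain \<mu> F \<epsilon> where U: "U = weak_nhd X \<mu> F \<epsilon>" "finite F" "F \<subseteq> cfun X" by blast
    have "openin Z {z \<in> topspace Z. \<Psi> z f \<in> {t. \<bar>\<mu> f - t\<bar> < \<epsilon>}}" if "f \<in> F" for f
    proof -
      have "open {t. \<bar>\<mu> f - t\<bar> < \<epsilon>}" by (intro open_Collect_less continuous_intros)
      moreover have "continuous_map Z euclideanreal (\<lambda>z. \<Psi> z f)" using R U that by blast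
      ultimately show ?thesis by (intro openin_continuous_map_preimage) auto
    qed
    then have "openin Z (topspace Z \<inter> (\<Inter>f\<in>F. {z \<in> topspace Z. \<Psi> z f \<in> {t. \<bar>\<mu> f - t\<bar> < \<epsilon>}}))"
      using U(2) by (cases "F = {}") (auto intro!: openin_Int openin_Inter)
    moreover have "topspace Z \<inter> (\<Inter>f\<in>F. {z \<in> topspace Z. \<Psi> z f \<in> {t. \<bar>\<mu> f - t\<bar> < \<epsilon>}}) =
        \<Psi> -` U \<inter> topspace Z"
      using R by (auto simp: U weak_nhd_def)
    ultimately show "openin Z (\<Psi> -` U \<inter> topspace Z)" by simp
  qed
qed

lemma continuous_map_idem_map:
  assumes f: "continuous_map X Y f"
  shows "continuous_map (idem_space X) (idem_space Y) (idem_map X Y f)"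
proof -
  have "continuous_map (idem_space X) euclideanreal (\<lambda>\<mu>. idem_map X Y f \<mu> g)"
    if g: "g \<in> cfun Y" for g
  proof -
    have "restrict (g \<circ> f) (topspace X) \<in> cfun X"
      using continuous_map_compose[OF f cfun_continuous[OF g]] by (rule restrict_in_cfun)
    then have "continuous_map (idem_space X) euclideanreal (\<lambda>\<mu>. \<mu> (restrict (g \<circ> f) (topspace X)))"
      using continuous_map_idem_space[of "idem_space X" X "\<lambda>\<mu>. \<mu>"] continuous_map_id[of "idem_space X"]
      by (auto simp: id_def)
    with g show ?thesis by (simp add: idem_map_def)
  qed
  with idem_map_in_idem_measures[OF _ f] show ?thesis
    by (auto simp: continuous_map_idem_space)
qed

section \<open>Finite maxima and minima of functions\<close>

lemma abs_Max_image_diff_le: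
  fixes f g :: "'i \<Rightarrow> real"
  assumes "finite M" "M \<noteq> {}" "\<And>i. i \<in> M \<Longrightarrow> \<bar>f i - g i\<bar> \<le> e"
  shows "\<bar>Max (f ` M) - Max (g ` M)\<bar> \<le> e"
proof -
  have "f i \<le> Max (g ` M) + e" "g i \<le> Max (f ` M) + e" if "i \<in> M" for i
    using assms(3)[OF that] Max_ge[OF finite_imageI[OF assms(1)] imageI[OF that, of g]]
      Max_ge[OF finite_imageI[OF assms(1)] imageI[OF that, of f]] by linarith+
  then have "Max (f ` M) \<le> Max (g ` M) + e" "Max (g ` M) \<le> Max (f ` M) + e"
    using assms(1,2) by (auto simp: Max_le_iff)
  then show ?thesis by linarith
qed

lemma Min_image_eq_uminus_Max:
  fixes f :: "'i \<Rightarrow> real"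
  assumes "finite M" "M \<noteq> {}"
  shows "Min (f ` M) = - Max ((\<lambda>i. - f i) ` M)"
proof -
  have "Min (f ` M) = Min (uminus ` (\<lambda>i. - f i) ` M)"
    by (simp add: image_image)
  also have "\<dots> = - Max ((\<lambda>i. - f i) ` M)"
    using assms by (intro minus_Max_eq_Min[symmetric]) auto
  finally show ?thesis .
qed

lemma abs_Min_image_diff_le:
  fixes f g :: "'i \<Rightarrow> real"
  assumes "finite M" "M \<noteq> {}" "\<And>i. i \<in> M \<Longrightarrow> \<bar>f i - g i\<bar> \<le> e"
  shows "\<bar>Min (f ` M) - Min (g ` M)\<bar> \<le> e"
proof -
  have "\<bar>Max ((\<lambda>i. - f i) ` M) - Max ((\<lambda>i. - g i) ` M)\<bar> \<le> e"
    using assms(3) by (intro abs_Max_image_diff_le[OF assms(1,2)]) fastforce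
  then show ?thesis
    by (simp add: Min_image_eq_uminus_Max[OF assms(1,2)])
qed

lemma continuous_map_Max_image:
  assumes "finite M" "M \<noteq> {}" "\<And>i. i \<in> M \<Longrightarrow> continuous_map X euclideanreal (f i)"
  shows "continuous_map X euclideanreal (\<lambda>x. Max ((\<lambda>i. f i x) ` M))"
  using assms
proof (induction rule: finite_ne_induct)
  case (insert i M)
  then have "continuous_map X euclideanreal (\<lambda>x. max (f i x) (Max ((\<lambda>i. f i x) ` M)))"
    by (intro continuous_map_real_max) auto
  with insert.hyps show ?case by simp
qed auto

lemma continuous_map_Min_image:
  assumes "finite M" "M \<noteq> {}" "\<And>i. i \<in> M \<Longrightarrow> continuous_map X euclideanreal (f i)"
  shows "continuous_map X euclideanreal (\<lambda>x. Min ((\<lambda>i. f i x) ` M))"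
  unfolding Min_image_eq_uminus_Max[OF assms(1,2)]
  by (intro continuous_map_minus continuous_map_Max_image assms)

lemma Max_image_max:
  fixes f g :: "'i \<Rightarrow> real"
  assumes "finite M" "M \<noteq> {}"
  shows "Max ((\<lambda>i. max (f i) (g i)) ` M) = max (Max (f ` M)) (Max (g ` M))"
  using assms by (induction rule: finite_ne_induct) (auto simp: max.assoc max.left_commute)

lemma continuous_map_realI:
  assumes "\<And>z e. z \<in> topspace Z \<Longrightarrow> e > 0 \<Longrightarrow>
    \<exists>U. openin Z U \<and> z \<in> U \<and> (\<forall>w\<in>U. \<bar>f w - f z\<bar> < (e::real))"
  shows "continuous_map Z euclideanreal f"
  using assms Met_TC.continuous_map_to_metric[of Z f]
  by (simp add: dist_real_def abs_minus_commute)

lemma continuous_map_realD: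
  assumes "continuous_map Z euclideanreal f" "z \<in> topspace Z" "e > 0"
  shows "\<exists>U. openin Z U \<and> z \<in> U \<and> (\<forall>w\<in>U. \<bar>f w - f z\<bar> < (e::real))"
  using assms(1)[unfolded Met_TC.continuous_map_to_metric[of Z f, simplified], rule_format, OF assms(2,3)]
  by (simp add: dist_real_def abs_minus_commute)

section \<open>Lifting a measure along a kernel\<close>

text \<open>This is the operator \<open>T\<^sub>k\<close> of the introduction. The maximum runs over a finite set \<open>M\<close> of
  points of the fibre, which keeps all continuity questions elementary. The second maximum
  normalizes the kernel: it makes \<open>T\<^sub>k\<close> the identity on functions that only depend on \<open>x\<close>.\<close>

definition lift_fun :: "'b set \<Rightarrow> ('a \<times> 'b \<Rightarrow> real) \<Rightarrow> ('a \<times> 'b \<Rightarrow> real) \<Rightarrow> 'a \<Rightarrow> real"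
  where "lift_fun M k f x = Max ((\<lambda>y. f (x, y) + k (x, y)) ` M) - Max ((\<lambda>y. k (x, y)) ` M)"

definition lift_measure ::
  "'a topology \<Rightarrow> 'b topology \<Rightarrow> 'b set \<Rightarrow> ('a \<times> 'b \<Rightarrow> real) \<Rightarrow> (('a \<Rightarrow> real) \<Rightarrow> real) \<Rightarrow>
    ('a \<times> 'b \<Rightarrow> real) \<Rightarrow> real"
  where "lift_measure X Y M k \<nu> = (\<lambda>f\<in>cfun (prod_topology X Y). ev X \<nu> (lift_fun M k f))"

lemma continuous_map_slice:
  assumes "continuous_map (prod_topology X Y) euclideanreal f" "y \<in> topspace Y"
  shows "continuous_map X euclideanreal (\<lambda>x. f (x, y))"
proof -
  have "continuous_map X (prod_topology X Y) (\<lambda>x. (x, y))"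
    using assms(2) by (intro continuous_map_pairedI) auto
  from continuous_map_compose[OF this assms(1)] show ?thesis by (simp add: o_def)
qed

locale lifting_kernel =
  fixes X :: "'a topology" and Y :: "'b topology" and M :: "'b set"
    and k :: "'a \<times> 'b \<Rightarrow> real"
  assumes M: "finite M" "M \<noteq> {}" "M \<subseteq> topspace Y"
    and k: "\<And>y. y \<in> M \<Longrightarrow> continuous_map X euclideanreal (\<lambda>x. k (x, y))"
begin

lemma continuous_map_lift_fun:
  assumes "continuous_map (prod_topology X Y) euclideanreal f"
  shows "continuous_map X euclideanreal (lift_fun M k f)"
  unfolding lift_fun_def
  using M continuous_map_slice[OF assms]
  by (intro continuous_map_diff continuous_map_Max_image continuous_map_add k) auto

lemma lift_fun_cong:
  assumes "\<And>w. w \<in> topspace (prod_topology X Y) \<Longrightarrow> f w = g w" "x \<in> topspace X"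
  shows "lift_fun M k f x = lift_fun M k g x"
proof -
  have "f (x, y) = g (x, y)" if "y \<in> M" for y
    using assms M that by (intro assms(1)) auto
  then have "(\<lambda>y. f (x, y) + k (x, y)) ` M = (\<lambda>y. g (x, y) + k (x, y)) ` M"
    by (intro image_cong) auto
  then show ?thesis by (simp add: lift_fun_def)
qed

lemma lift_fun_add_fst: "lift_fun M k (\<lambda>w. h (fst w) + f w) = (\<lambda>x. h x + lift_fun M k f x)"
proof
  show "lift_fun M k (\<lambda>w. h (fst w) + f w) x = h x + lift_fun M k f x" for x
    using Max_add_commute[OF M(1,2), of "\<lambda>y. f (x, y) + k (x, y)" "h x"]
    by (simp add: lift_fun_def algebra_simps)
qed

lemma lift_fun_fst: "lift_fun M k (\<lambda>w. h (fst w)) = h"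
  using lift_fun_add_fst[of h "\<lambda>w. 0"] by (simp add: lift_fun_def)

lemma lift_fun_max:
  "lift_fun M k (\<lambda>w. max (f w) (g w)) = (\<lambda>x. max (lift_fun M k f x) (lift_fun M k g x))"
proof
  show "lift_fun M k (\<lambda>w. max (f w) (g w)) x = max (lift_fun M k f x) (lift_fun M k g x)" for x
    using Max_image_max[OF M(1,2), of "\<lambda>y. f (x, y) + k (x, y)" "\<lambda>y. g (x, y) + k (x, y)"]
    by (simp add: lift_fun_def max_add_distrib_left max_diff_distrib_left)
qed

lemma ev_lift_cong:
  assumes "\<And>w. w \<in> topspace (prod_topology X Y) \<Longrightarrow> f w = g w"
  shows "ev X \<nu> (lift_fun M k f) = ev X \<nu> (lift_fun M k g)"
  using lift_fun_cong[OF assms] by (intro ev_cong) auto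

lemma lift_measure_in_idem_measures:
  assumes \<nu>: "\<nu> \<in> idem_measures X"
  shows "lift_measure X Y M k \<nu> \<in> idem_measures (prod_topology X Y)"
  unfolding lift_measure_def
proof (rule restrict_in_idem_measures)
  show "ev X \<nu> (lift_fun M k (\<lambda>w. c)) = c" for c
    using ev_const[OF \<nu>] lift_fun_fst[of "\<lambda>x. c"] by simp
  show "ev X \<nu> (lift_fun M k (\<lambda>w. c + f w)) = c + ev X \<nu> (lift_fun M k f)"
    if "continuous_map (prod_topology X Y) euclideanreal f" for c f
    using ev_add_const[OF \<nu> continuous_map_lift_fun[OF that]] lift_fun_add_fst[of "\<lambda>x. c" f]
    by simp
  show "ev X \<nu> (lift_fun M k (\<lambda>w. max (f w) (g w))) =
      max (ev X \<nu> (lift_fun M k f)) (ev X \<nu> (lift_fun M k g))"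
    if "continuous_map (prod_topology X Y) euclideanreal f"
      "continuous_map (prod_topology X Y) euclideanreal g" for f g
    using ev_max[OF \<nu> continuous_map_lift_fun[OF that(1)] continuous_map_lift_fun[OF that(2)]]
      lift_fun_max[of f g]
    by simp
qed (rule ev_lift_cong)

lemma ev_lift_measure:
  assumes "continuous_map (prod_topology X Y) euclideanreal f"
  shows "ev (prod_topology X Y) (lift_measure X Y M k \<nu>) f = ev X \<nu> (lift_fun M k f)"
  unfolding lift_measure_def using assms by (intro ev_restrict ev_lift_cong)

lemma idem_map_lift_measure:
  assumes \<nu>: "\<nu> \<in> idem_measures X"
  shows "idem_map (prod_topology X Y) X fst (lift_measure X Y M k \<nu>) = \<nu>"
proof (rule idem_measures_eqI)
  show "idem_map (prod_topology X Y) X fst (lift_measure X Y M k \<nu>) \<in> idem_measures X"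
    by (intro idem_map_in_idem_measures lift_measure_in_idem_measures \<nu> continuous_map_fst)
next
  fix g assume g: "g \<in> cfun X"
  have c: "continuous_map (prod_topology X Y) euclideanreal (\<lambda>w. g (fst w))"
    using continuous_map_compose[OF continuous_map_fst cfun_continuous[OF g]]
    by (simp add: o_def)
  have "idem_map (prod_topology X Y) X fst (lift_measure X Y M k \<nu>) g =
      ev X (idem_map (prod_topology X Y) X fst (lift_measure X Y M k \<nu>)) g"
    using ev_cfun[OF g] by simp
  also have "\<dots> = ev (prod_topology X Y) (lift_measure X Y M k \<nu>) (\<lambda>w. g (fst w))"
    by (intro ev_idem_map continuous_map_fst cfun_continuous g)
  also have "\<dots> = ev X \<nu> g"
    using ev_lift_measure[OF c] lift_fun_fst[of g] by simp
  finally show "idem_map (prod_topology X Y) X fst (lift_measure X Y M k \<nu>) g = \<nu> g"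
    using ev_cfun[OF g] by simp
qed (rule \<nu>)

end

lemma abs_lift_fun_diff_le:
  assumes M: "finite M" "M \<noteq> {}" and "\<And>y. y \<in> M \<Longrightarrow> \<bar>k (x, y) - k' (x, y)\<bar> \<le> e"
  shows "\<bar>lift_fun M k f x - lift_fun M k' f x\<bar> \<le> 2 * e"
proof -
  have "\<bar>Max ((\<lambda>y. f (x, y) + k (x, y)) ` M) - Max ((\<lambda>y. f (x, y) + k' (x, y)) ` M)\<bar> \<le> e"
    using assms(3) by (intro abs_Max_image_diff_le[OF M]) auto
  moreover have "\<bar>Max ((\<lambda>y. k (x, y)) ` M) - Max ((\<lambda>y. k' (x, y)) ` M)\<bar> \<le> e"
    using assms(3) by (intro abs_Max_image_diff_le[OF M]) auto
  ultimately show ?thesis unfolding lift_fun_def by linarith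
qed

text \<open>The measure \<open>\<psi> z\<close> and the function to which it is applied both vary with \<open>z\<close>. Since
  idempotent measures are nonexpansive for the supremum norm, uniform convergence of the
  kernels suffices.\<close>

lemma continuous_map_lift_measure:
  assumes \<psi>: "continuous_map Z (idem_space X) \<psi>"
    and ker: "\<And>z. z \<in> topspace Z \<Longrightarrow> lifting_kernel X Y M (k z)"
    and unif: "\<And>z e. z \<in> topspace Z \<Longrightarrow> e > 0 \<Longrightarrow>
      \<exists>U. openin Z U \<and> z \<in> U \<and>
        (\<forall>z'\<in>U. \<forall>x\<in>topspace X. \<forall>y\<in>M. \<bar>k z' (x, y) - k z (x, y)\<bar> \<le> e)"
  shows "continuous_map Z (idem_space (prod_topology X Y)) (\<lambda>z. lift_measure X Y M (k z) (\<psi> z))"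
  unfolding continuous_map_idem_space
proof (intro conjI ballI)
  have \<psi>I: "\<psi> z \<in> idem_measures X" if "z \<in> topspace Z" for z
    using \<psi> that by (auto simp: continuous_map_idem_space)
  show "lift_measure X Y M (k z) (\<psi> z) \<in> idem_measures (prod_topology X Y)"
    if "z \<in> topspace Z" for z
    using lifting_kernel.lift_measure_in_idem_measures[OF ker \<psi>I] that by blast
  fix f assume f: "f \<in> cfun (prod_topology X Y)"
  have cont: "continuous_map X euclideanreal (lift_fun M (k z) f)" if "z \<in> topspace Z" for z
    using lifting_kernel.continuous_map_lift_fun[OF ker cfun_continuous[OF f]] that by blast
  have "continuous_map Z euclideanreal (\<lambda>z. ev X (\<psi> z) (lift_fun M (k z) f))"
  proof (rule continuous_map_realI)
    fix z and e :: real assume z: "z \<in> topspace Z" "e > 0"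
    obtain U where U: "openin Z U" "z \<in> U"
      "\<forall>z'\<in>U. \<forall>x\<in>topspace X. \<forall>y\<in>M. \<bar>k z' (x, y) - k z (x, y)\<bar> \<le> e / 4"
      using unif[OF z(1), of "e / 4"] z(2) by auto
    have "continuous_map Z euclideanreal (\<lambda>z'. ev X (\<psi> z') (lift_fun M (k z) f))"
      using \<psi> restrict_in_cfun[OF cont[OF z(1)]] unfolding continuous_map_idem_space ev_def
      by blast
    from continuous_map_realD[OF this z(1), of "e / 2"] z(2)
    obtain V where V: "openin Z V" "z \<in> V"
      "\<forall>z'\<in>V. \<bar>ev X (\<psi> z') (lift_fun M (k z) f) - ev X (\<psi> z) (lift_fun M (k z) f)\<bar> < e / 2"
      by auto
    have "\<bar>ev X (\<psi> z') (lift_fun M (k z') f) - ev X (\<psi> z) (lift_fun M (k z) f)\<bar> < e"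
      if z': "z' \<in> U \<inter> V" for z'
    proof -
      have z'Z: "z' \<in> topspace Z" using openin_subset[OF U(1)] z' by auto
      have "\<bar>ev X (\<psi> z') (lift_fun M (k z') f) - ev X (\<psi> z') (lift_fun M (k z) f)\<bar> \<le> 2 * (e / 4)"
      proof (intro ev_nonexpansive \<psi>I cont z'Z z(1) abs_lift_fun_diff_le)
        show "finite M" "M \<noteq> {}" using ker[OF z(1)] by (auto simp: lifting_kernel_def)
      qed (use U z' in auto)
      moreover have "\<bar>ev X (\<psi> z') (lift_fun M (k z) f) - ev X (\<psi> z) (lift_fun M (k z) f)\<bar> < e / 2"
        using V z' by auto
      ultimately show ?thesis by linarith
    qed
    with U V show "\<exists>U. openin Z U \<and> z \<in> U \<and>
        (\<forall>z'\<in>U. \<bar>ev X (\<psi> z') (lift_fun M (k z') f) - ev X (\<psi> z) (lift_fun M (k z) f)\<bar> < e)"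
      by (intro exI[of _ "U \<inter> V"]) auto
  qed
  with f show "continuous_map Z euclideanreal (\<lambda>z. lift_measure X Y M (k z) (\<psi> z) f)"
    by (simp add: lift_measure_def)
qed

section \<open>Cones over a finite net\<close>

text \<open>The cone with vertex \<open>i\<close> and slope \<open>s\<close>. A measure with density \<open>\<lambda>\<close> takes on it the value
  \<open>max\<^sub>w (\<lambda> w - s d(w, i))\<close>, the Lipschitz regularization of \<open>\<lambda>\<close> at \<open>i\<close>.\<close>

definition cone_fun :: "'c metric \<Rightarrow> real \<Rightarrow> 'c \<Rightarrow> 'c \<Rightarrow> real"
  where "cone_fun m s i w = - s * mdist m w i"

lemma continuous_map_cone:
  "i \<in> mspace m \<Longrightarrow> continuous_map (mtopology_of m) euclideanreal (cone_fun m s i)"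
  unfolding cone_fun_def
  by (intro continuous_intros continuous_map_id[unfolded id_def]) auto

text \<open>\<open>B\<close> is a bound of \<open>f\<close>, and \<open>r\<close> is a distance over which \<open>f\<close> varies by at most \<open>\<eta>\<close>. When \<open>2 B \<le> s r\<close>,
  a cone of slope \<open>s\<close> with its vertex on the graph of \<open>f\<close> has dropped to \<open>- B\<close> or below at the distance \<open>r\<close>,
  so that it cannot exceed \<open>f\<close> by more than \<open>\<eta>\<close> (lemma \<open>cone_le\<close>). Conversely, cones with vertices
  in a fine net reach up to \<open>f\<close> within \<open>2 \<eta>\<close> (lemma \<open>le_cone\<close>). So \<open>f\<close> is a finite maximum of
  cones up to a small error.\<close>

definition controlled :: "'c metric \<Rightarrow> real \<Rightarrow> real \<Rightarrow> real \<Rightarrow> ('c \<Rightarrow> real) \<Rightarrow> bool"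
  where "controlled m \<eta> B r f \<longleftrightarrow>
    (\<forall>w\<in>mspace m. \<bar>f w\<bar> \<le> B) \<and>
    (\<forall>w\<in>mspace m. \<forall>w'\<in>mspace m. mdist m w w' \<le> r \<longrightarrow> \<bar>f w - f w'\<bar> \<le> \<eta>)"

lemma controlled_bound: "controlled m \<eta> B r f \<Longrightarrow> w \<in> mspace m \<Longrightarrow> \<bar>f w\<bar> \<le> B"
  by (simp add: controlled_def)

lemma controlled_osc:
  "controlled m \<eta> B r f \<Longrightarrow> w \<in> mspace m \<Longrightarrow> w' \<in> mspace m \<Longrightarrow> mdist m w w' \<le> r \<Longrightarrow>
    \<bar>f w - f w'\<bar> \<le> \<eta>"
  by (simp add: controlled_def)

lemma controlled_mono:
  "controlled m \<eta> B r f \<Longrightarrow> B \<le> B' \<Longrightarrow> r' \<le> r \<Longrightarrow> controlled m \<eta> B' r' f"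
  unfolding controlled_def by (meson order_trans)

lemma ex_controlled:
  assumes C: "compact_space (mtopology_of m)"
    and f: "continuous_map (mtopology_of m) euclideanreal f" and "\<eta> > 0"
  shows "\<exists>B>0. \<exists>r>0. controlled m \<eta> B r f"
proof -
  have "compactin (mtopology_of m) (topspace (mtopology_of m))"
    using C by (simp add: compact_space_def)
  from image_compactin[OF this f] have "bounded (f ` mspace m)"
    by (simp add: compact_imp_bounded)
  then obtain B where "B > 0" and B: "\<forall>w\<in>mspace m. \<bar>f w\<bar> \<le> B"
    by (auto simp: bounded_pos)
  have "uniformly_continuous_map m euclidean_metric f"
    using C f by (intro continuous_imp_uniformly_continuous_map) auto
  then obtain r where "r > 0" and
    r: "\<forall>w\<in>mspace m. \<forall>w'\<in>mspace m. mdist m w' w < r \<longrightarrow> dist (f w') (f w) < \<eta>"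
    using \<open>\<eta> > 0\<close> unfolding uniformly_continuous_map_def by auto
  have "\<bar>f w - f w'\<bar> \<le> \<eta>" if "w \<in> mspace m" "w' \<in> mspace m" "mdist m w w' \<le> r / 2" for w w'
  proof -
    have "dist (f w) (f w') < \<eta>"
      using r that \<open>r > 0\<close> by auto
    then show ?thesis by (simp add: dist_real_def)
  qed
  with B \<open>B > 0\<close> \<open>r > 0\<close> show ?thesis
    unfolding controlled_def by (intro exI[of _ B] conjI exI[of _ "r / 2"]) auto
qed

lemma ex_controlled_finite:
  assumes "finite F" and C: "compact_space (mtopology_of m)"
    and "\<And>f. f \<in> F \<Longrightarrow> continuous_map (mtopology_of m) euclideanreal f" and "\<eta> > 0"
  shows "\<exists>B>0. \<exists>r>0. \<forall>f\<in>F. controlled m \<eta> B r f"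
  using assms(1,3)
proof (induction rule: finite_induct)
  case empty
  show ?case by (auto intro: exI[of _ 1])
next
  case (insert f F)
  obtain B r where Br: "B > 0" "r > 0" "\<forall>f\<in>F. controlled m \<eta> B r f"
    using insert by auto
  obtain B' r' where Br': "B' > 0" "r' > 0" "controlled m \<eta> B' r' f"
    using ex_controlled[OF C _ \<open>\<eta> > 0\<close>] insert.prems by blast
  have "\<forall>g\<in>insert f F. controlled m \<eta> (max B B') (min r r') g"
    using Br(3) Br'(3) by (auto intro: controlled_mono)
  with Br(1,2) Br'(1,2) show ?case
    by (intro exI[of _ "max B B'"] conjI exI[of _ "min r r'"]) auto
qed

lemma cone_le:
  assumes f: "controlled m \<eta> B r f" and "s \<ge> 0" "2 * B \<le> s * r" "\<eta> \<ge> 0"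
    and w: "w \<in> mspace m" "i \<in> mspace m"
  shows "f i + cone_fun m s i w \<le> f w + \<eta>"
proof (cases "mdist m w i \<le> r")
  case True
  then have "\<bar>f w - f i\<bar> \<le> \<eta>" using f w by (simp add: controlled_def)
  moreover have "cone_fun m s i w \<le> 0" using \<open>s \<ge> 0\<close> by (simp add: cone_fun_def)
  ultimately show ?thesis by linarith
next
  case False
  then have "s * r \<le> s * mdist m w i" using \<open>s \<ge> 0\<close> by (intro mult_left_mono) auto
  moreover have "\<bar>f w\<bar> \<le> B" "\<bar>f i\<bar> \<le> B" using f w by (auto simp: controlled_def)
  ultimately show ?thesis
    unfolding cone_fun_def using assms(3,4) by linarith
qed

lemma le_cone:
  assumes f: "controlled m \<eta> B r f" and w: "w \<in> mspace m" "i \<in> mspace m"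
    and "mdist m w i \<le> r" "s * mdist m w i \<le> \<eta>"
  shows "f w \<le> f i + cone_fun m s i w + 2 * \<eta>"
proof -
  have "\<bar>f w - f i\<bar> \<le> \<eta>" using assms by (simp add: controlled_def)
  then show ?thesis using assms(5) by (simp add: cone_fun_def)
qed

definition net :: "'c metric \<Rightarrow> real \<Rightarrow> 'c set \<Rightarrow> bool"
  where "net m \<delta> N \<longleftrightarrow> finite N \<and> N \<subseteq> mspace m \<and> (\<forall>w\<in>mspace m. \<exists>i\<in>N. mdist m w i \<le> \<delta>)"

lemma ex_net:
  assumes C: "compact_space (mtopology_of m)" and "\<delta> > 0"
  shows "\<exists>N. net m \<delta> N"
proof -
  interpret Metric_space "mspace m" "mdist m" by simp
  have "mtotally_bounded (mspace m)"
    using C compactin_imp_mtotally_bounded[of "mspace m"]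
    by (simp add: mtopology_of_def compact_space_def)
  then have "\<exists>N. finite N \<and> N \<subseteq> mspace m \<and> mspace m \<subseteq> (\<Union>x\<in>N. mball x \<delta>)"
    using \<open>\<delta> > 0\<close> unfolding mtotally_bounded_def by simp
  then obtain N where N: "finite N" "N \<subseteq> mspace m" "mspace m \<subseteq> (\<Union>x\<in>N. mball x \<delta>)"
    by (elim exE conjE)
  have "\<exists>i\<in>N. mdist m w i \<le> \<delta>" if w: "w \<in> mspace m" for w
  proof -
    obtain i where "i \<in> N" "w \<in> mball i \<delta>" using N(3) w by blast
    then show ?thesis using commute[of w i] by (intro bexI[of _ i]) (auto simp: in_mball)
  qed
  with N show ?thesis by (auto simp: net_def)
qed

text \<open>In terms of densities, \<open>i\<close> is a point of the net near a point at which \<open>f + \<lambda>\<close>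
  attains its maximum.\<close>

lemma ev_le_cone:
  assumes C: "net m \<delta> N" "N \<noteq> {}" and f: "continuous_map (mtopology_of m) euclideanreal f"
    and ctrl: "controlled m \<eta> B r f" and "s > 0" "\<delta> \<le> r" "s * \<delta> \<le> \<eta>"
    and \<mu>: "\<mu> \<in> idem_measures (mtopology_of m)"
  shows "\<exists>i\<in>N. ev (mtopology_of m) \<mu> f \<le> f i + 2 * \<eta> + ev (mtopology_of m) \<mu> (cone_fun m s i)"
proof -
  have N: "finite N" "N \<subseteq> mspace m" "\<And>w. w \<in> mspace m \<Longrightarrow> \<exists>i\<in>N. mdist m w i \<le> \<delta>"
    using C by (auto simp: net_def)
  have cont: "continuous_map (mtopology_of m) euclideanreal (cone_fun m s i)" if "i \<in> N" for i
    using N that by (intro continuous_map_cone) auto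
  have "\<exists>g\<in>(\<lambda>i w. (f i + 2 * \<eta>) + cone_fun m s i w) ` N.
      ev (mtopology_of m) \<mu> f \<le> ev (mtopology_of m) \<mu> g"
  proof (rule ev_dominated[OF \<mu>])
    fix w assume "w \<in> topspace (mtopology_of m)"
    then have w: "w \<in> mspace m" by simp
    then obtain i where i: "i \<in> N" "mdist m w i \<le> \<delta>" using N(3) by blast
    have "s * mdist m w i \<le> s * \<delta>" using i \<open>s > 0\<close> by simp
    then have "f w \<le> f i + cone_fun m s i w + 2 * \<eta>"
      using w i N(2) assms(6,7) by (intro le_cone[OF ctrl]) auto
    then have "f w \<le> (\<lambda>i w. (f i + 2 * \<eta>) + cone_fun m s i w) i w" by simp
    with i(1) show "\<exists>g\<in>(\<lambda>i w. (f i + 2 * \<eta>) + cone_fun m s i w) ` N. f w \<le> g w"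
      by (intro bexI[OF _ imageI]) auto
  qed (use N(1) C(2) f cont in \<open>auto intro!: continuous_map_add\<close>)
  then obtain i where i: "i \<in> N"
    "ev (mtopology_of m) \<mu> f \<le> ev (mtopology_of m) \<mu> (\<lambda>w. (f i + 2 * \<eta>) + cone_fun m s i w)"
    by blast
  then have "ev (mtopology_of m) \<mu> f \<le> f i + 2 * \<eta> + ev (mtopology_of m) \<mu> (cone_fun m s i)"
    using ev_add_const[OF \<mu> cont[OF i(1)]] by metis
  with i(1) show ?thesis by blast
qed

section \<open>The lift of the marginal approximates the measure\<close>

text \<open>The metric of the product enters only through the comparison with the metrics
  of the factors in the next four lemmas, so its definition as a square root stays folded.\<close>

declare mdist_prod_metric [simp del]

lemma mdist_fst_le:
  "mdist X (fst v) (fst w) \<le> mdist (prod_metric X Y) v w"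
  by (cases v; cases w) (simp add: mdist_prod_metric prod_dist_def)

lemma mdist_snd_le:
  "mdist Y (snd v) (snd w) \<le> mdist (prod_metric X Y) v w"
  by (cases v; cases w) (simp add: mdist_prod_metric prod_dist_def)

lemma mdist_same_fst: "x \<in> mspace X \<Longrightarrow> mdist (prod_metric X Y) (x, y) (x, y') = mdist Y y y'"
proof -
  assume "x \<in> mspace X"
  then have "mdist X x x = 0" by simp
  then show ?thesis by (simp add: mdist_prod_metric prod_dist_def)
qed

lemma mdist_same_snd: "y \<in> mspace Y \<Longrightarrow> mdist (prod_metric X Y) (x, y) (x', y) = mdist X x x'"
proof -
  assume "y \<in> mspace Y"
  then have "mdist Y y y = 0" by simp
  then show ?thesis by (simp add: mdist_prod_metric prod_dist_def)
qed

text \<open>With \<open>a i = \<mu> (- s d(\<cdot>, i))\<close> and \<open>b i = \<nu> (- S d(\<cdot>, fst i))\<close> this is a discretization of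
  \<open>min (\<lambda>\<^sub>s w) (\<kappa>\<^sub>S (fst w))\<close>: each of the functions \<open>a i + s d(w, i)\<close> majorizes \<open>\<lambda>\<^sub>s\<close>, with equality at
  \<open>w = i\<close>. Written in this way the kernel depends on the measures only through finitely many
  numbers, and makes sense for arbitrary \<open>a\<close> and \<open>b\<close>.\<close>

definition cone_kernel ::
  "'a metric \<Rightarrow> 'b metric \<Rightarrow> ('a \<times> 'b) set \<Rightarrow> real \<Rightarrow> real \<Rightarrow>
    ('a \<times> 'b \<Rightarrow> real) \<Rightarrow> ('a \<times> 'b \<Rightarrow> real) \<Rightarrow> 'a \<times> 'b \<Rightarrow> real"
  where "cone_kernel X Y N s S a b w =
    Min ((\<lambda>i. min (a i - cone_fun (prod_metric X Y) s i w) (b i - cone_fun X S (fst i) (fst w))) ` N)"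

lemma kernel_cone_kernel:
  fixes X :: "'a metric" and Y :: "'b metric"
  assumes N: "finite N" "N \<noteq> {}" "N \<subseteq> mspace (prod_metric X Y)"
  shows "lifting_kernel (mtopology_of X) (mtopology_of Y) (snd ` N) (cone_kernel X Y N s S a b)"
proof
  show "finite (snd ` N)" "snd ` N \<noteq> {}" "snd ` N \<subseteq> topspace (mtopology_of Y)"
    using N by auto
  fix y assume y: "y \<in> snd ` N"
  have "continuous_map (mtopology_of X) euclideanreal (\<lambda>x. cone_fun (prod_metric X Y) s i (x, y))"
    if "i \<in> N" for i
    using continuous_map_slice[of "mtopology_of X" "mtopology_of Y" "cone_fun (prod_metric X Y) s i" y]
      continuous_map_cone[of i "prod_metric X Y" s] subsetD[OF N(3) that] subsetD[OF N(3)] y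
    by auto
  moreover have "continuous_map (mtopology_of X) euclideanreal (cone_fun X S (fst i))" if "i \<in> N" for i
    using N that by (intro continuous_map_cone) auto
  ultimately show "continuous_map (mtopology_of X) euclideanreal (\<lambda>x. cone_kernel X Y N s S a b (x, y))"
    unfolding cone_kernel_def using N
    by (intro continuous_map_Min_image continuous_map_real_min continuous_map_diff) auto
qed

text \<open>The condition \<open>2 B \<le> s r\<close> makes cones of slope \<open>s\<close> steep enough for \<open>f\<close>;
  \<open>s (2 B) \<le> \<eta> S\<close> says that over a distance \<open>2 B / S\<close>, on which a cone of slope \<open>S\<close> loses \<open>2 B\<close>
  and thereby all that \<open>f\<close> can vary, a cone of slope \<open>s\<close> loses at most \<open>\<eta>\<close>; and \<open>S \<delta> \<le> \<eta>\<close> says that the net is fine enough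
  for the steeper cones.\<close>

locale two_scales =
  fixes X :: "'a metric" and Y :: "'b metric"
    and \<mu> :: "('a \<times> 'b \<Rightarrow> real) \<Rightarrow> real" and \<nu> :: "('a \<Rightarrow> real) \<Rightarrow> real"
    and N :: "('a \<times> 'b) set" and s S \<eta> B r \<delta> :: real and f :: "'a \<times> 'b \<Rightarrow> real"
    and a b :: "'a \<times> 'b \<Rightarrow> real"
  assumes \<mu>: "\<mu> \<in> idem_measures (prod_topology (mtopology_of X) (mtopology_of Y))"
    and \<nu>: "\<nu> = idem_map (prod_topology (mtopology_of X) (mtopology_of Y)) (mtopology_of X) fst \<mu>"
    and net: "net (prod_metric X Y) \<delta> N" and Nne: "N \<noteq> {}"
    and f: "continuous_map (prod_topology (mtopology_of X) (mtopology_of Y)) euclideanreal f"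
    and ctrl: "controlled (prod_metric X Y) \<eta> B r f"
    and pos: "\<eta> > 0" "B > 0" "s > 0"
    and scales: "2 * B \<le> s * r" "s \<le> S" "s * (2 * B) \<le> \<eta> * S" "S * \<delta> \<le> \<eta>" "\<delta> \<le> r"
    and a: "\<And>i. i \<in> N \<Longrightarrow>
      a i = ev (prod_topology (mtopology_of X) (mtopology_of Y)) \<mu> (cone_fun (prod_metric X Y) s i)"
    and b: "\<And>i. i \<in> N \<Longrightarrow> b i = ev (mtopology_of X) \<nu> (cone_fun X S (fst i))"
begin

abbreviation "W \<equiv> prod_topology (mtopology_of X) (mtopology_of Y)"
abbreviation "m \<equiv> prod_metric X Y"
abbreviation "M \<equiv> snd ` N"
abbreviation "k \<equiv> cone_kernel X Y N s S a b"

lemma finite_N: "finite N" and N_sub: "N \<subseteq> mspace m"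
  using net by (auto simp: net_def)

sublocale lifting_kernel "mtopology_of X" "mtopology_of Y" M k
  by (intro kernel_cone_kernel finite_N Nne N_sub)

lemma N_mem: "i \<in> N \<Longrightarrow> i \<in> mspace m" "i \<in> N \<Longrightarrow> fst i \<in> mspace X" "i \<in> N \<Longrightarrow> snd i \<in> mspace Y"
  using N_sub by auto

lemma S_pos: "S > 0" using pos scales by linarith

lemma r_pos: "r > 0"
proof -
  have "s * r > 0" using scales(1) pos by linarith
  then show ?thesis using pos(3) zero_less_mult_pos by blast
qed

lemma near: "w \<in> mspace m \<Longrightarrow> \<exists>i\<in>N. mdist m w i \<le> \<delta>"
  using net unfolding net_def by blast

lemma s_delta: "d \<le> \<delta> \<Longrightarrow> s * d \<le> \<eta>" "d \<le> \<delta> \<Longrightarrow> S * d \<le> \<eta>"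
proof -
  assume "d \<le> \<delta>"
  then show "S * d \<le> \<eta>" using S_pos scales(4) by (smt (verit) mult_left_mono)
  show "s * d \<le> \<eta>"
  proof (cases "d \<ge> 0")
    case True
    then have "s * d \<le> S * d" using scales(2) by (intro mult_right_mono) auto
    with \<open>S * d \<le> \<eta>\<close> show ?thesis by simp
  next
    case False
    then have "s * d \<le> 0" using pos(3) by (simp add: mult_nonneg_nonpos)
    then show ?thesis using pos(1) by simp
  qed
qed

lemma cont_cone: "i \<in> mspace m \<Longrightarrow> continuous_map W euclideanreal (cone_fun m t i)"
  using continuous_map_cone[of i m t] by simp

lemma cont_fst: "continuous_map (mtopology_of X) euclideanreal h \<Longrightarrow>
    continuous_map W euclideanreal (\<lambda>w. h (fst w))"
  using continuous_map_compose[OF continuous_map_fst] by (simp add: o_def)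

lemma ev_marginal: "continuous_map (mtopology_of X) euclideanreal h \<Longrightarrow>
    ev (mtopology_of X) \<nu> h = ev W \<mu> (\<lambda>w. h (fst w))"
  unfolding \<nu> by (intro ev_idem_map continuous_map_fst)

lemma cont_cone_fst: "i \<in> N \<Longrightarrow> continuous_map W euclideanreal (\<lambda>w. cone_fun X t (fst i) (fst w))"
  by (intro cont_fst continuous_map_cone N_mem)

lemma kernel_le:
  assumes "i \<in> N"
  shows "k w \<le> a i - cone_fun m s i w" "k w \<le> b i - cone_fun X S (fst i) (fst w)"
proof -
  have "k w \<le> min (a i - cone_fun m s i w) (b i - cone_fun X S (fst i) (fst w))"
    unfolding cone_kernel_def using finite_N assms by (intro Min_le) auto
  then show "k w \<le> a i - cone_fun m s i w" "k w \<le> b i - cone_fun X S (fst i) (fst w)"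
    by simp_all
qed

lemma kernel_attained:
  "\<exists>i\<in>N. k w = a i - cone_fun m s i w \<or> k w = b i - cone_fun X S (fst i) (fst w)"
proof -
  have "k w \<in> (\<lambda>i. min (a i - cone_fun m s i w) (b i - cone_fun X S (fst i) (fst w))) ` N"
    unfolding cone_kernel_def using finite_N Nne by (intro Min_in) auto
  then show ?thesis by (auto simp: min_def split: if_splits)
qed

text \<open>Near \<open>i \<in> N\<close> the kernel is at most about \<open>a i\<close>, and \<open>f i + a i\<close> is the value of \<open>\<mu>\<close> on a
  cone that lies below \<open>f + \<eta>\<close>.\<close>

lemma add_kernel_le:
  assumes w: "w \<in> mspace m"
  shows "f w + k w \<le> ev W \<mu> f + 3 * \<eta>"
proof -
  obtain i where i: "i \<in> N" "mdist m w i \<le> \<delta>" using near[OF w] by blast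
  have "ev W \<mu> (cone_fun m s i) \<le> (\<eta> - f i) + ev W \<mu> f"
  proof (rule ev_le_add[OF \<mu> cont_cone f])
    fix v assume "v \<in> topspace W"
    then have "f i + cone_fun m s i v \<le> f v + \<eta>"
      using pos scales N_mem[OF i(1)] by (intro cone_le[OF ctrl]) auto
    then show "cone_fun m s i v \<le> \<eta> - f i + f v" by simp
  qed (use N_mem(1)[OF i(1)] in auto)
  moreover have "k w \<le> a i + \<eta>"
    using kernel_le(1)[OF i(1), of w] s_delta(1)[OF i(2)] by (simp add: cone_fun_def)
  moreover have "\<bar>f w - f i\<bar> \<le> \<eta>"
    using controlled_osc[OF ctrl w N_mem(1)[OF i(1)]] i(2) scales(5) by linarith
  ultimately show ?thesis using a[OF i(1)] by linarith
qed

lemma lift_fun_le: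
  assumes x: "x \<in> mspace X" and y: "y \<in> M"
  shows "lift_fun M k f x \<le> ev W \<mu> f + 3 * \<eta> - k (x, y)"
proof -
  have "f (x, y') + k (x, y') \<le> ev W \<mu> f + 3 * \<eta>" if "y' \<in> M" for y'
    using x that N_mem by (intro add_kernel_le) auto
  then have "Max ((\<lambda>y. f (x, y) + k (x, y)) ` M) \<le> ev W \<mu> f + 3 * \<eta>"
    using M(1,2) by (subst Max_le_iff) auto
  moreover have "k (x, y) \<le> Max ((\<lambda>y. k (x, y)) ` M)"
    using M(1) y by (intro Max_ge) auto
  ultimately show ?thesis unfolding lift_fun_def by linarith
qed

text \<open>By \<open>lift_fun_le\<close> the lifted function is at most \<open>D - k\<close>, and \<open>- k\<close> is dominated by the cones
  \<open>- a i - s d(\<cdot>, i)\<close> and \<open>- b i - S d(\<cdot>, fst i)\<close>, whose values under \<open>\<mu>\<close> and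
  \<open>\<nu>\<close> are \<open>0\<close> by the choice of \<open>a\<close> and \<open>b\<close>. In densities: \<open>\<kappa> \<le> max\<^sub>y k\<close> up to \<open>\<eta>\<close>.\<close>

lemma ev_lift_fun_le: "ev (mtopology_of X) \<nu> (lift_fun M k f) \<le> ev W \<mu> f + 4 * \<eta>"
proof -
  define D where "D = ev W \<mu> f + 3 * \<eta>"
  define g1 where "g1 i w = (D - b i) + cone_fun X S (fst i) (fst w)" for i and w :: "'a \<times> 'b"
  define g2 where "g2 i w = (D + \<eta> - a i) + cone_fun m s i w" for i w
  have cont: "continuous_map W euclideanreal (g1 i)" "continuous_map W euclideanreal (g2 i)"
    if "i \<in> N" for i
    unfolding g1_def g2_def using that
    by (intro continuous_map_add cont_cone_fst cont_cone N_mem(1) continuous_map_const[THEN iffD2]; simp)+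
  have "\<exists>g\<in>g1 ` N \<union> g2 ` N. ev W \<mu> (\<lambda>w. lift_fun M k f (fst w)) \<le> ev W \<mu> g"
  proof (rule ev_dominated[OF \<mu>])
    fix w assume "w \<in> topspace W"
    then obtain x y where w: "w = (x, y)" "x \<in> mspace X" "y \<in> mspace Y" by auto
    then have wm: "w \<in> mspace m" by simp
    then obtain j where j: "j \<in> N" "mdist m w j \<le> \<delta>" using near by blast
    (* The point y itself need not belong to M; replacing it by y' costs at most eta because
       the cones of slope s are s-Lipschitz. *)
    define y' where "y' = snd j"
    have y': "y' \<in> M" "y' \<in> mspace Y" using j N_mem by (auto simp: y'_def)
    have le: "lift_fun M k f x \<le> D - k (x, y')"
      unfolding D_def by (rule lift_fun_le[OF w(2) y'(1)])
    obtain i where i: "i \<in> N"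
      "k (x, y') = a i - cone_fun m s i (x, y') \<or> k (x, y') = b i - cone_fun X S (fst i) x"
      using kernel_attained[of "(x, y')"] by auto
    from i(2) show "\<exists>g\<in>g1 ` N \<union> g2 ` N. lift_fun M k f (fst w) \<le> g w"
    proof
      assume "k (x, y') = b i - cone_fun X S (fst i) x"
      then have "lift_fun M k f (fst w) \<le> g1 i w"
        using le w by (simp add: g1_def)
      then show ?thesis using i(1) by blast
    next
      assume k: "k (x, y') = a i - cone_fun m s i (x, y')"
      have "mdist m w (x, y') \<le> \<delta>"
        using j(2) w mdist_same_fst[of x X Y y y'] mdist_snd_le[of Y w j X]
        by (simp add: y'_def)
      moreover have "mdist m w i \<le> mdist m w (x, y') + mdist m (x, y') i"
        using w y' N_mem[OF i(1)] by (intro mdist_triangle) auto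
      then have "s * mdist m w i \<le> s * mdist m w (x, y') + s * mdist m (x, y') i"
        using pos(3) by (metis distrib_left less_imp_le mult_left_mono)
      ultimately have "cone_fun m s i (x, y') \<le> cone_fun m s i w + \<eta>"
        using s_delta(1)[of "mdist m w (x, y')"] by (simp add: cone_fun_def)
      then have "lift_fun M k f (fst w) \<le> g2 i w"
        using le k w by (simp add: g2_def)
      then show ?thesis using i(1) by blast
    qed
  qed (use finite_N Nne cont in \<open>auto intro!: cont_fst continuous_map_lift_fun f\<close>)
  then obtain g where g: "g \<in> g1 ` N \<union> g2 ` N" "ev W \<mu> (\<lambda>w. lift_fun M k f (fst w)) \<le> ev W \<mu> g"
    by blast
  have "ev W \<mu> (g1 i) = D" if "i \<in> N" for i
    unfolding g1_def using ev_add_const[OF \<mu> cont_cone_fst[OF that, of S], of "D - b i"] b[OF that]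
      ev_marginal[OF continuous_map_cone[OF N_mem(2)[OF that]], of S] by simp
  moreover have "ev W \<mu> (g2 i) = D + \<eta>" if "i \<in> N" for i
    unfolding g2_def using ev_add_const[OF \<mu> cont_cone[OF N_mem(1)[OF that], of s], of "D + \<eta> - a i"]
      a[OF that] by simp
  ultimately have "ev W \<mu> g \<le> D + \<eta>" using g(1) pos(1) by auto
  then show ?thesis
    using g(2) ev_marginal[OF continuous_map_lift_fun[OF f]] by (simp add: D_def)
qed

lemma lift_fun_ge_bound:
  assumes x: "x \<in> mspace X"
  shows "- B \<le> lift_fun M k f x"
proof -
  have "k (x, y) \<le> B + Max ((\<lambda>y. f (x, y) + k (x, y)) ` M)" if y: "y \<in> M" for y
  proof -
    have "\<bar>f (x, y)\<bar> \<le> B" using x y N_mem by (intro controlled_bound[OF ctrl]) auto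
    moreover have "f (x, y) + k (x, y) \<le> Max ((\<lambda>y. f (x, y) + k (x, y)) ` M)"
      using M(1) y by (intro Max_ge) auto
    ultimately show ?thesis by linarith
  qed
  then have "Max ((\<lambda>y. k (x, y)) ` M) \<le> B + Max ((\<lambda>y. f (x, y) + k (x, y)) ` M)"
    using M(1,2) by (subst Max_le_iff) auto
  then show ?thesis unfolding lift_fun_def by linarith
qed

text \<open>The kernel never exceeds \<open>b i + S d(x, fst i)\<close>, so neither does the normalizing
  maximum.\<close>

lemma lift_fun_ge:
  assumes x: "x \<in> mspace X" and y: "y \<in> M" and i: "i \<in> N"
  shows "f (x, y) + k (x, y) - (b i - cone_fun X S (fst i) x) \<le> lift_fun M k f x"
proof -
  have "Max ((\<lambda>y. k (x, y)) ` M) \<le> b i - cone_fun X S (fst i) x"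
    using M(1,2) kernel_le(2)[OF i, of "(x, _)"] by (subst Max_le_iff) auto
  moreover have "f (x, y) + k (x, y) \<le> Max ((\<lambda>y. f (x, y) + k (x, y)) ` M)"
    using M(1) y by (intro Max_ge) auto
  ultimately show ?thesis unfolding lift_fun_def by linarith
qed

lemma cone_le_marginal:
  assumes i: "i \<in> N"
  shows "ev W \<mu> (cone_fun m S i) \<le> b i"
proof -
  have "ev W \<mu> (cone_fun m S i) \<le> ev W \<mu> (\<lambda>w. cone_fun X S (fst i) (fst w))"
    using S_pos mdist_fst_le[of X _ i Y]
    by (intro ev_mono[OF \<mu>] cont_cone cont_cone_fst i N_mem) (simp add: cone_fun_def)
  then show ?thesis
    using b[OF i] ev_marginal[OF continuous_map_cone[OF N_mem(2)[OF i]], of S] by simp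
qed

text \<open>The heart of the lower bound: up to a constant, the lifted function majorizes a cone of
  slope \<open>S\<close> with vertex \<open>fst i\<close>, whose \<open>\<nu>\<close>-value is \<open>b i\<close> by definition; after
  integration \<open>b i\<close> cancels and leaves \<open>f i + c - 2 \<eta>\<close>. At a distance above \<open>2 B / S\<close> the
  cone is too low to matter. Closer to the vertex, \<open>f\<close> and the cones of slope \<open>s\<close> change by at
  most \<open>\<eta>\<close>, so the part of the kernel that comes from \<open>a\<close> is still at least \<open>c - \<eta>\<close>, while the
  normalizing maximum is at most \<open>b i + S d(x, fst i)\<close>.\<close>

lemma cone_lift_fun:
  assumes i: "i \<in> N" and x: "x \<in> mspace X"
  defines "c \<equiv> ev W \<mu> (cone_fun m S i)"
  shows "cone_fun X S (fst i) x \<le> (b i - f i - c + 2 * \<eta>) + lift_fun M k f x"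
proof (cases "S * mdist X x (fst i) \<le> 2 * B")
  case False
  have "\<bar>f i\<bar> \<le> B" by (rule controlled_bound[OF ctrl N_mem(1)[OF i]])
  then show ?thesis
    using False lift_fun_ge_bound[OF x] cone_le_marginal[OF i] pos unfolding c_def cone_fun_def
    by linarith
next
  case True
  define y where "y = snd i"
  define v where "v = (x, y)"
  have v: "v \<in> mspace m" using x N_mem[OF i] by (auto simp: v_def y_def)
  have dv: "mdist m v i = mdist X x (fst i)"
    using mdist_same_snd[of y Y X x "fst i"] N_mem[OF i] by (simp add: v_def y_def)
  have "s * (S * mdist m v i) \<le> s * (2 * B)"
    using True pos(3) dv by simp
  then have "S * (s * mdist m v i) \<le> S * \<eta>" using scales(3) by (simp add: mult.left_commute mult.commute)
  then have sv: "s * mdist m v i \<le> \<eta>" using S_pos by simp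
  have "S * mdist m v i \<le> s * r" using True scales(1) by (simp add: dv)
  also have "s * r \<le> S * r"
    using scales(2) r_pos by (intro mult_right_mono) auto
  finally have "mdist m v i \<le> r" using S_pos by simp
  then have fv: "\<bar>f v - f i\<bar> \<le> \<eta>"
    by (rule controlled_osc[OF ctrl v N_mem(1)[OF i]])
  have lower: "c - \<eta> \<le> a j - cone_fun m s j v" if j: "j \<in> N" for j
  proof -
    have "cone_fun m S i w \<le> (\<eta> - cone_fun m s j v) + cone_fun m s j w" if "w \<in> topspace W" for w
    proof -
      have w: "w \<in> mspace m" using that by auto
      have "mdist m w j \<le> mdist m w i + mdist m i j" "mdist m i j \<le> mdist m i v + mdist m v j"
        using w v N_mem[OF i] N_mem[OF j] by (auto intro!: mdist_triangle)
      then have "mdist m w j \<le> mdist m w i + mdist m v i + mdist m v j"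
        by (simp add: mdist_commute)
      then have "s * mdist m w j \<le> s * (mdist m w i + mdist m v i + mdist m v j)"
        using pos(3) by (intro mult_left_mono) auto
      then have "s * mdist m w j \<le> s * mdist m w i + s * mdist m v i + s * mdist m v j"
        by (simp add: distrib_left)
      moreover have "s * mdist m w i \<le> S * mdist m w i"
        using scales(2) by (intro mult_right_mono) auto
      ultimately show ?thesis using sv by (simp add: cone_fun_def)
    qed
    then have "c \<le> (\<eta> - cone_fun m s j v) + ev W \<mu> (cone_fun m s j)"
      unfolding c_def using N_mem i j by (intro ev_le_add[OF \<mu>] cont_cone) auto
    then show ?thesis using a[OF j] by linarith
  qed
  have y: "y \<in> M" using i by (simp add: y_def)
  obtain j where j: "j \<in> N" "k v = a j - cone_fun m s j v \<or> k v = b j - cone_fun X S (fst j) x"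
    using kernel_attained[of v] by (auto simp: v_def)
  (* In the second case the kernel attains its upper bound over the fibre of x, so the
     normalization removes all of it. *)
  from j(2) show ?thesis
  proof
    assume "k v = a j - cone_fun m s j v"
    then have "c - \<eta> \<le> k v" using lower[OF j(1)] by simp
    then show ?thesis
      using lift_fun_ge[OF x y i] fv unfolding v_def by linarith
  next
    assume "k v = b j - cone_fun X S (fst j) x"
    then have "f v \<le> lift_fun M k f x"
      using lift_fun_ge[OF x y j(1)] unfolding v_def by linarith
    moreover have "cone_fun X S (fst i) x \<le> 0" using S_pos by (simp add: cone_fun_def)
    ultimately show ?thesis
      using fv cone_le_marginal[OF i] pos(1) unfolding c_def by linarith
  qed
qed

text \<open>By \<open>ev_le_cone\<close> at slope \<open>S\<close> there is a vertex \<open>i\<close> for which \<open>f i\<close> plus the value of the cone at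
  \<open>i\<close> is almost \<open>\<mu> f\<close>. Apply \<open>\<nu>\<close> to the inequality of \<open>cone_lift_fun\<close> for this \<open>i\<close>.\<close>

lemma ev_lift_fun_ge: "ev W \<mu> f \<le> ev (mtopology_of X) \<nu> (lift_fun M k f) + 4 * \<eta>"
proof -
  have fm: "continuous_map (mtopology_of m) euclideanreal f"
    "\<mu> \<in> idem_measures (mtopology_of m)"
    using f \<mu> by simp_all
  obtain i where i: "i \<in> N" "ev W \<mu> f \<le> f i + 2 * \<eta> + ev W \<mu> (cone_fun m S i)"
    using ev_le_cone[OF net Nne fm(1) ctrl _ scales(5,4) fm(2)] S_pos by auto
  have "b i \<le> (b i - f i - ev W \<mu> (cone_fun m S i) + 2 * \<eta>) +
      ev (mtopology_of X) \<nu> (lift_fun M k f)"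
    using cone_lift_fun[OF i(1)] N_mem(2)[OF i(1)] unfolding b[OF i(1)]
    by (intro ev_le_add continuous_map_cone continuous_map_lift_fun f)
      (auto simp: \<nu> intro!: idem_map_in_idem_measures \<mu> continuous_map_fst)
  with i(2) show ?thesis by linarith
qed

lemma abs_ev_lift_fun_diff_le: "\<bar>ev (mtopology_of X) \<nu> (lift_fun M k f) - ev W \<mu> f\<bar> \<le> 4 * \<eta>"
  using ev_lift_fun_le ev_lift_fun_ge by linarith

end

section \<open>Approximate lifts\<close>

lemma continuous_map_finite_real:
  assumes "finite N" "\<And>i. i \<in> N \<Longrightarrow> continuous_map Z euclideanreal (h i)"
    "z \<in> topspace Z" "(e::real) > 0"
  shows "\<exists>U. openin Z U \<and> z \<in> U \<and> (\<forall>w\<in>U. \<forall>i\<in>N. \<bar>h i w - h i z\<bar> < e)"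
  using assms(1,2)
proof (induction rule: finite_induct)
  case empty
  show ?case using assms(3) by (intro exI[of _ "topspace Z"]) auto
next
  case (insert i N)
  obtain U where U: "openin Z U" "z \<in> U" "\<forall>w\<in>U. \<forall>i\<in>N. \<bar>h i w - h i z\<bar> < e"
    using insert by auto
  have "continuous_map Z euclideanreal (h i)" using insert.prems by simp
  from continuous_map_realD[OF this assms(3,4)]
  obtain V where V: "openin Z V" "z \<in> V" "\<forall>w\<in>V. \<bar>h i w - h i z\<bar> < e" by auto
  from U V show ?case by (intro exI[of _ "U \<inter> V"]) auto
qed

lemma abs_cone_kernel_diff_le:
  assumes "finite N" "N \<noteq> {}"
    and "\<And>i. i \<in> N \<Longrightarrow> \<bar>a i - a' i\<bar> \<le> e" "\<And>i. i \<in> N \<Longrightarrow> \<bar>b i - b' i\<bar> \<le> e"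
  shows "\<bar>cone_kernel X Y N s S a b w - cone_kernel X Y N s S a' b' w\<bar> \<le> e"
  unfolding cone_kernel_def
proof (rule abs_Min_image_diff_le[OF assms(1,2)])
  fix i assume "i \<in> N"
  then show "\<bar>min (a i - cone_fun (prod_metric X Y) s i w) (b i - cone_fun X S (fst i) (fst w)) -
      min (a' i - cone_fun (prod_metric X Y) s i w) (b' i - cone_fun X S (fst i) (fst w))\<bar> \<le> e"
    using assms(3,4)[of i] by (simp add: min_def abs_le_iff)
qed

lemma idem_space_evaluation:
  assumes "continuous_map Z (idem_space X) \<psi>" "continuous_map X euclideanreal h"
  shows "continuous_map Z euclideanreal (\<lambda>z. ev X (\<psi> z) h)"
  using assms restrict_in_cfun[of X h] unfolding continuous_map_idem_space ev_def by blast

text \<open>Only the numbers \<open>a i\<close> have to be extended from \<open>A\<close>: the kernel makes sense for whatever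
  values the extensions take off \<open>A\<close>, and the marginal of the lifted measure is \<open>\<psi> z\<close> for every
  kernel.\<close>

lemma ex_approximate_lift:
  fixes X :: "'a metric" and Y :: "'b metric"
  defines "W \<equiv> prod_topology (mtopology_of X) (mtopology_of Y)"
  assumes C: "compact_space W" and ne: "mspace X \<noteq> {}" "mspace Y \<noteq> {}"
    and Z: "normal_space Z" and A: "closedin Z A"
    and \<phi>: "continuous_map (subtopology Z A) (idem_space W) \<phi>"
    and \<psi>: "continuous_map Z (idem_space (mtopology_of X)) \<psi>"
    and comm: "\<And>z. z \<in> A \<Longrightarrow> idem_map W (mtopology_of X) fst (\<phi> z) = \<psi> z"
    and F: "finite F" "F \<subseteq> cfun W" and "\<epsilon> > 0"
  shows "\<exists>\<Phi>. continuous_map Z (idem_space W) \<Phi> \<and>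
    (\<forall>z\<in>topspace Z. idem_map W (mtopology_of X) fst (\<Phi> z) = \<psi> z) \<and>
    (\<forall>z\<in>A. \<forall>f\<in>F. \<bar>\<Phi> z f - \<phi> z f\<bar> < \<epsilon>)"
proof -
  define m where "m = prod_metric X Y"
  have mW: "mtopology_of m = W" by (simp add: m_def W_def)
  have mne: "mspace m \<noteq> {}" using ne by (auto simp: m_def)
  define \<eta> where "\<eta> = \<epsilon> / 5"
  have \<eta>: "\<eta> > 0" using \<open>\<epsilon> > 0\<close> by (simp add: \<eta>_def)
  obtain B r where Br: "B > 0" "r > 0" "\<forall>f\<in>F. controlled m \<eta> B r f"
    using ex_controlled_finite[OF F(1), of m \<eta>] C F(2) \<eta> by (auto simp: mW cfun_def)
  (* The factor of s in S is chosen so that s * (2 * B) = \<eta> * (S - s). *)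
  define s where "s = 2 * B / r"
  define S where "S = s * (1 + 2 * B / \<eta>)"
  define \<delta> where "\<delta> = min r (\<eta> / S)"
  have s: "s > 0" "2 * B \<le> s * r" using Br by (auto simp: s_def)
  have S: "s \<le> S" "s * (2 * B) \<le> \<eta> * S" "S > 0"
    using s \<eta> Br by (auto simp: S_def field_simps intro: add_pos_pos)
  have \<delta>: "\<delta> > 0" "\<delta> \<le> r" "S * \<delta> \<le> \<eta>"
    using Br(2) \<eta> S(3) by (auto simp: \<delta>_def min_def field_simps)
  obtain N where N: "net m \<delta> N" using ex_net[of m \<delta>] C \<delta>(1) by (auto simp: mW)
  have Nfin: "finite N" and Nsub: "N \<subseteq> mspace m" and Nne: "N \<noteq> {}"
    using N mne by (auto simp: net_def)
  have contm: "continuous_map W euclideanreal (cone_fun m s i)" if "i \<in> N" for i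
    using continuous_map_cone[of i m s] Nsub that by (auto simp: mW)
  have contX: "continuous_map (mtopology_of X) euclideanreal (cone_fun X S (fst i))" if "i \<in> N" for i
    using continuous_map_cone[of "fst i" X S] Nsub that by (auto simp: m_def)
  have "\<exists>h. continuous_map Z euclideanreal h \<and> (\<forall>z\<in>A. h z = ev W (\<phi> z) (cone_fun m s i))"
    if i: "i \<in> N" for i
  proof -
    have "continuous_map (subtopology Z A) euclideanreal (\<lambda>z. ev W (\<phi> z) (cone_fun m s i))"
      by (rule idem_space_evaluation[OF \<phi> contm[OF i]])
    then obtain h where "continuous_map Z euclideanreal h"
        "\<And>z. z \<in> A \<Longrightarrow> h z = ev W (\<phi> z) (cone_fun m s i)"
      using Tietze_extension_realinterval[OF Z A is_interval_univ UNIV_not_empty, of "\<lambda>z. ev W (\<phi> z) (cone_fun m s i)"]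
      by auto
    then show ?thesis by blast
  qed
  then obtain a where a: "\<And>i. i \<in> N \<Longrightarrow> continuous_map Z euclideanreal (a i)"
      "\<And>i z. i \<in> N \<Longrightarrow> z \<in> A \<Longrightarrow> a i z = ev W (\<phi> z) (cone_fun m s i)"
    by metis
  define b where "b i z = ev (mtopology_of X) (\<psi> z) (cone_fun X S (fst i))" for i :: "'a \<times> 'b" and z
  have b: "continuous_map Z euclideanreal (b i)" if "i \<in> N" for i
    unfolding b_def by (rule idem_space_evaluation[OF \<psi> contX[OF that]])
  define k where "k z = cone_kernel X Y N s S (\<lambda>i. a i z) (\<lambda>i. b i z)" for z
  have ker: "lifting_kernel (mtopology_of X) (mtopology_of Y) (snd ` N) (k z)" for z
    unfolding k_def using Nfin Nne Nsub by (intro kernel_cone_kernel) (auto simp: m_def)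
  define \<Phi> where "\<Phi> z = lift_measure (mtopology_of X) (mtopology_of Y) (snd ` N) (k z) (\<psi> z)" for z
  have "continuous_map Z (idem_space W) \<Phi>"
    unfolding \<Phi>_def W_def
  proof (rule continuous_map_lift_measure[OF \<psi> ker])
    fix z and e :: real assume z: "z \<in> topspace Z" "e > 0"
    obtain U where U: "openin Z U" "z \<in> U" "\<forall>z'\<in>U. \<forall>i\<in>N. \<bar>a i z' - a i z\<bar> < e"
      using continuous_map_finite_real[where h = a, OF Nfin a(1) z] by auto
    obtain V where V: "openin Z V" "z \<in> V" "\<forall>z'\<in>V. \<forall>i\<in>N. \<bar>b i z' - b i z\<bar> < e"
      using continuous_map_finite_real[where h = b, OF Nfin b z] by auto
    have "\<bar>k z' w - k z w\<bar> \<le> e" if "z' \<in> U \<inter> V" for z' w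
      unfolding k_def using U V that
      by (intro abs_cone_kernel_diff_le[OF Nfin Nne]) (auto intro: less_imp_le)
    with U V show "\<exists>U. openin Z U \<and> z \<in> U \<and>
        (\<forall>z'\<in>U. \<forall>x\<in>topspace (mtopology_of X). \<forall>y\<in>snd ` N. \<bar>k z' (x, y) - k z (x, y)\<bar> \<le> e)"
      by (intro exI[of _ "U \<inter> V"]) auto
  qed
  moreover have "idem_map W (mtopology_of X) fst (\<Phi> z) = \<psi> z" if "z \<in> topspace Z" for z
    unfolding \<Phi>_def W_def using \<psi> that
    by (intro lifting_kernel.idem_map_lift_measure[OF ker]) (auto simp: continuous_map_idem_space)
  moreover have "\<bar>\<Phi> z f - \<phi> z f\<bar> < \<epsilon>" if z: "z \<in> A" and f: "f \<in> F" for z f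
  proof -
    have fc: "f \<in> cfun W" using f F by auto
    have zZ: "z \<in> topspace (subtopology Z A)" using closedin_subset[OF A] z by auto
    interpret two_scales X Y "\<phi> z" "\<psi> z" N s S \<eta> B r \<delta> f "\<lambda>i. a i z" "\<lambda>i. b i z"
    proof
      show "\<phi> z \<in> idem_measures (prod_topology (mtopology_of X) (mtopology_of Y))"
        using \<phi> zZ unfolding continuous_map_idem_space W_def by blast
      show "\<psi> z = idem_map (prod_topology (mtopology_of X) (mtopology_of Y)) (mtopology_of X) fst (\<phi> z)"
        using comm[OF z] by (simp add: W_def)
      show "continuous_map (prod_topology (mtopology_of X) (mtopology_of Y)) euclideanreal f"
        using cfun_continuous[OF fc] by (simp add: W_def)
      show "controlled (prod_metric X Y) \<eta> B r f" using Br f by (auto simp: m_def)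
      show "net (prod_metric X Y) \<delta> N" using N by (simp add: m_def)
      show "a i z = ev (prod_topology (mtopology_of X) (mtopology_of Y)) (\<phi> z) (cone_fun (prod_metric X Y) s i)"
        if "i \<in> N" for i using a(2)[OF that z] by (simp add: m_def W_def)
    qed (use s S \<delta> \<eta> Br Nne b_def in auto)
    have "ev W (\<Phi> z) f = ev (mtopology_of X) (\<psi> z) (lift_fun (snd ` N) (k z) f)"
      unfolding \<Phi>_def W_def using lifting_kernel.ev_lift_measure[OF ker] cfun_continuous[OF fc]
      by (simp add: W_def)
    then have "\<bar>ev W (\<Phi> z) f - ev W (\<phi> z) f\<bar> \<le> 4 * \<eta>"
      using abs_ev_lift_fun_diff_le by (simp add: k_def W_def)
    then show ?thesis using \<eta> by (simp add: ev_cfun[OF fc] \<eta>_def)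
  qed
  ultimately show ?thesis by blast
qed

section \<open>A sequence of finite sets that determines idempotent measures\<close>

lemma ev_le_of_cones:
  assumes C: "net m \<delta> N" "N \<noteq> {}" and f: "continuous_map (mtopology_of m) euclideanreal f"
    and ctrl: "controlled m \<eta> B r f" and "\<eta> > 0" "s > 0" "2 * B \<le> s * r" "\<delta> \<le> r" "s * \<delta> \<le> \<eta>"
    and \<mu>: "\<mu> \<in> idem_measures (mtopology_of m)" and \<nu>: "\<nu> \<in> idem_measures (mtopology_of m)"
    and close: "\<And>i. i \<in> N \<Longrightarrow>
      ev (mtopology_of m) \<mu> (cone_fun m s i) \<le> ev (mtopology_of m) \<nu> (cone_fun m s i) + \<eta>"
  shows "ev (mtopology_of m) \<mu> f \<le> ev (mtopology_of m) \<nu> f + 4 * \<eta>"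
proof -
  obtain i where i: "i \<in> N"
    "ev (mtopology_of m) \<mu> f \<le> f i + 2 * \<eta> + ev (mtopology_of m) \<mu> (cone_fun m s i)"
    using ev_le_cone[OF C f ctrl \<open>s > 0\<close> assms(8,9) \<mu>] by blast
  have iN: "i \<in> mspace m" using i(1) C by (auto simp: net_def)
  have "ev (mtopology_of m) \<nu> (cone_fun m s i) \<le> (\<eta> - f i) + ev (mtopology_of m) \<nu> f"
  proof (rule ev_le_add[OF \<nu> continuous_map_cone[OF iN] f])
    fix w assume "w \<in> topspace (mtopology_of m)"
    then have "f i + cone_fun m s i w \<le> f w + \<eta>"
      using assms(5-7) iN by (intro cone_le[OF ctrl]) auto
    then show "cone_fun m s i w \<le> \<eta> - f i + f w" by simp
  qed
  then show ?thesis using i(2) close[OF i(1)] by linarith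
qed

text \<open>The values on the finite sets \<open>F n\<close> control the value on every continuous function,
  uniformly over all measures. The sets increase, so closeness on \<open>F n\<close> is a condition that gets
  stronger with \<open>n\<close>.\<close>

definition determining :: "'c topology \<Rightarrow> (nat \<Rightarrow> ('c \<Rightarrow> real) set) \<Rightarrow> bool"
  where "determining W F \<longleftrightarrow>
    (\<forall>n. finite (F n) \<and> F n \<subseteq> cfun W) \<and> mono F \<and>
    (\<forall>f\<in>cfun W. \<forall>\<epsilon>>0. \<exists>n. \<exists>\<delta>>0. \<forall>\<mu>\<in>idem_measures W. \<forall>\<nu>\<in>idem_measures W.
      (\<forall>g\<in>F n. \<bar>\<mu> g - \<nu> g\<bar> \<le> \<delta>) \<longrightarrow> \<bar>\<mu> f - \<nu> f\<bar> \<le> \<epsilon>)"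

lemma ex_determining:
  assumes C: "compact_space (mtopology_of m)" and ne: "mspace m \<noteq> {}"
  shows "\<exists>F. determining (mtopology_of m) F"
proof -
  (* For slope n + 1 the mesh must be small even after multiplication by the slope. *)
  have "\<exists>N. net m (1 / (real (Suc n))\<^sup>2) N" for n
    by (intro ex_net C) auto
  then obtain N where N: "\<And>n. net m (1 / (real (Suc n))\<^sup>2) (N n)" by metis
  define G where "G n = (\<lambda>i. restrict (cone_fun m (real (Suc n)) i) (mspace m)) ` N n" for n
  define F where "F n = (\<Union>k\<le>n. G k)" for n
  have G: "finite (G n)" "G n \<subseteq> cfun (mtopology_of m)" for n
    using N[of n] restrict_in_cfun[OF continuous_map_cone[of _ m "real (Suc n)"]]
    by (auto simp: G_def net_def)
  have "\<exists>n. \<exists>\<delta>>0. \<forall>\<mu>\<in>idem_measures (mtopology_of m). \<forall>\<nu>\<in>idem_measures (mtopology_of m).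
      (\<forall>g\<in>F n. \<bar>\<mu> g - \<nu> g\<bar> \<le> \<delta>) \<longrightarrow> \<bar>\<mu> f - \<nu> f\<bar> \<le> \<epsilon>"
    if f: "f \<in> cfun (mtopology_of m)" and "\<epsilon> > 0" for f \<epsilon>
  proof -
    define \<eta> where "\<eta> = \<epsilon> / 4"
    have \<eta>: "\<eta> > 0" using \<open>\<epsilon> > 0\<close> by (simp add: \<eta>_def)
    obtain B r where Br: "B > 0" "r > 0" "controlled m \<eta> B r f"
      using ex_controlled[OF C cfun_continuous[OF f] \<eta>] by blast
    obtain n where n: "real n \<ge> max (2 * B / r) (max (1 / r) (1 / \<eta>))"
      using real_arch_simple by blast
    define s where "s = real (Suc n)"
    have s: "s \<ge> 1" "s \<ge> 2 * B / r" "s \<ge> 1 / r" "s \<ge> 1 / \<eta>" using n by (auto simp: s_def)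
    have 1: "2 * B \<le> s * r" using s(2) Br by (simp add: field_simps)
    have "1 / s\<^sup>2 \<le> 1 / s" using s(1) by (simp add: field_simps power2_eq_square)
    also have "1 / s \<le> r" using s(1,3) Br by (simp add: field_simps)
    finally have 2: "1 / s\<^sup>2 \<le> r" .
    have 3: "s * (1 / s\<^sup>2) \<le> \<eta>" using s(1,4) \<eta> by (simp add: field_simps power2_eq_square)
    have Nn: "net m (1 / s\<^sup>2) (N n)" "N n \<noteq> {}"
      using N[of n] ne by (auto simp: s_def net_def)
    have le: "\<mu> f \<le> \<nu> f + \<epsilon>"
      if \<mu>: "\<mu> \<in> idem_measures (mtopology_of m)" and \<nu>: "\<nu> \<in> idem_measures (mtopology_of m)"
        and close: "\<forall>g\<in>F n. \<bar>\<mu> g - \<nu> g\<bar> \<le> \<eta>" for \<mu> \<nu>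
    proof -
      have "ev (mtopology_of m) \<mu> (cone_fun m s i) \<le> ev (mtopology_of m) \<nu> (cone_fun m s i) + \<eta>"
        if "i \<in> N n" for i
      proof -
        have "restrict (cone_fun m s i) (mspace m) \<in> F n"
          using that by (auto simp: F_def G_def s_def)
        with close have "\<bar>\<mu> (restrict (cone_fun m s i) (mspace m)) - \<nu> (restrict (cone_fun m s i) (mspace m))\<bar> \<le> \<eta>"
          by blast
        then show ?thesis by (simp add: ev_def)
      qed
      then have "ev (mtopology_of m) \<mu> f \<le> ev (mtopology_of m) \<nu> f + 4 * \<eta>"
        using s(1) by (intro ev_le_of_cones[OF Nn cfun_continuous[OF f] Br(3) \<eta> _ 1 2 3 \<mu> \<nu>]) auto
      then show ?thesis by (simp add: ev_cfun[OF f] \<eta>_def)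
    qed
    show ?thesis
    proof (intro exI[of _ n] exI[of _ \<eta>] conjI \<eta> ballI impI)
      fix \<mu> \<nu> assume "\<mu> \<in> idem_measures (mtopology_of m)" "\<nu> \<in> idem_measures (mtopology_of m)"
        and close: "\<forall>g\<in>F n. \<bar>\<mu> g - \<nu> g\<bar> \<le> \<eta>"
      then have "\<mu> f \<le> \<nu> f + \<epsilon>" "\<nu> f \<le> \<mu> f + \<epsilon>"
        using le[of \<mu> \<nu>] le[of \<nu> \<mu>] by (auto simp: abs_minus_commute)
      then show "\<bar>\<mu> f - \<nu> f\<bar> \<le> \<epsilon>" by linarith
    qed
  qed
  moreover have "mono F" unfolding F_def by (intro monoI UN_mono) auto
  moreover have "finite (F n) \<and> F n \<subseteq> cfun (mtopology_of m)" for n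
    using G by (auto simp: F_def)
  ultimately have "determining (mtopology_of m) F"
    unfolding determining_def by blast
  then show ?thesis by blast
qed

section \<open>Gluing and passing to the limit\<close>

text \<open>A max-plus convex combination, with weights \<open>- \<alpha>\<close> and \<open>- \<beta>\<close>: the combination is a measure
  when the larger weight is \<open>0\<close>.\<close>

definition glue ::
  "'a topology \<Rightarrow> real \<Rightarrow> (('a \<Rightarrow> real) \<Rightarrow> real) \<Rightarrow> real \<Rightarrow> (('a \<Rightarrow> real) \<Rightarrow> real) \<Rightarrow>
    ('a \<Rightarrow> real) \<Rightarrow> real"
  where "glue X \<alpha> \<mu> \<beta> \<nu> = (\<lambda>f\<in>cfun X. max (\<mu> f - \<alpha>) (\<nu> f - \<beta>))"

lemma glue_in_idem_measures:
  assumes \<mu>: "\<mu> \<in> idem_measures X" and \<nu>: "\<nu> \<in> idem_measures X" and "min \<alpha> \<beta> = 0"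
  shows "glue X \<alpha> \<mu> \<beta> \<nu> \<in> idem_measures X"
proof -
  have "restrict (\<lambda>f. max (ev X \<mu> f - \<alpha>) (ev X \<nu> f - \<beta>)) (cfun X) \<in> idem_measures X"
  proof (rule restrict_in_idem_measures)
    fix f g :: "'a \<Rightarrow> real" assume "\<And>x. x \<in> topspace X \<Longrightarrow> f x = g x"
    then have "ev X \<mu> f = ev X \<mu> g" "ev X \<nu> f = ev X \<nu> g" by (auto intro!: ev_cong)
    then show "max (ev X \<mu> f - \<alpha>) (ev X \<nu> f - \<beta>) = max (ev X \<mu> g - \<alpha>) (ev X \<nu> g - \<beta>)" by simp
  next
    show "max (ev X \<mu> (\<lambda>x. c) - \<alpha>) (ev X \<nu> (\<lambda>x. c) - \<beta>) = c" for c
      using assms(3) by (auto simp: ev_const[OF \<mu>] ev_const[OF \<nu>] min_def max_def split: if_splits)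
  next
    show "max (ev X \<mu> (\<lambda>x. c + f x) - \<alpha>) (ev X \<nu> (\<lambda>x. c + f x) - \<beta>) =
        c + max (ev X \<mu> f - \<alpha>) (ev X \<nu> f - \<beta>)"
      if "continuous_map X euclideanreal f" for c f
      using that by (simp add: ev_add_const[OF \<mu>] ev_add_const[OF \<nu>] max_def)
  next
    show "max (ev X \<mu> (\<lambda>x. max (f x) (g x)) - \<alpha>) (ev X \<nu> (\<lambda>x. max (f x) (g x)) - \<beta>) =
        max (max (ev X \<mu> f - \<alpha>) (ev X \<nu> f - \<beta>)) (max (ev X \<mu> g - \<alpha>) (ev X \<nu> g - \<beta>))"
      if "continuous_map X euclideanreal f" "continuous_map X euclideanreal g" for f g
      using that
      by (simp add: ev_max[OF \<mu>] ev_max[OF \<nu>] max_diff_distrib_left max.assoc max.left_commute)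
  qed
  moreover have "glue X \<alpha> \<mu> \<beta> \<nu> = restrict (\<lambda>f. max (ev X \<mu> f - \<alpha>) (ev X \<nu> f - \<beta>)) (cfun X)"
    by (auto simp: glue_def ev_cfun)
  ultimately show ?thesis by simp
qed

lemma idem_measures_tendsto:
  assumes \<mu>: "\<And>n. \<mu> n \<in> idem_measures X" and L: "\<And>f. f \<in> cfun X \<Longrightarrow> (\<lambda>n. \<mu> n f) \<longlonglongrightarrow> L f"
  shows "restrict L (cfun X) \<in> idem_measures X"
proof -
  have L': "(\<lambda>n. ev X (\<mu> n) f) \<longlonglongrightarrow> ev X L f" if "continuous_map X euclideanreal f" for f
    unfolding ev_def by (rule L[OF restrict_in_cfun[OF that]])
  have "restrict (ev X L) (cfun X) \<in> idem_measures X"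
  proof (rule restrict_in_idem_measures)
    show "ev X L (\<lambda>x. c) = c" for c
      using L'[of "\<lambda>x. c"] by (simp add: ev_const[OF \<mu>] LIMSEQ_const_iff)
    show "ev X L (\<lambda>x. c + f x) = c + ev X L f" if f: "continuous_map X euclideanreal f" for c f
    proof (rule LIMSEQ_unique)
      show "(\<lambda>n. ev X (\<mu> n) (\<lambda>x. c + f x)) \<longlonglongrightarrow> ev X L (\<lambda>x. c + f x)"
        using f by (intro L' continuous_map_add) auto
      show "(\<lambda>n. ev X (\<mu> n) (\<lambda>x. c + f x)) \<longlonglongrightarrow> c + ev X L f"
        unfolding ev_add_const[OF \<mu> f] by (intro tendsto_intros L' f)
    qed
    show "ev X L (\<lambda>x. max (f x) (g x)) = max (ev X L f) (ev X L g)"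
      if f: "continuous_map X euclideanreal f" and g: "continuous_map X euclideanreal g" for f g
    proof (rule LIMSEQ_unique)
      show "(\<lambda>n. ev X (\<mu> n) (\<lambda>x. max (f x) (g x))) \<longlonglongrightarrow> ev X L (\<lambda>x. max (f x) (g x))"
        by (intro L' continuous_map_real_max f g)
      show "(\<lambda>n. ev X (\<mu> n) (\<lambda>x. max (f x) (g x))) \<longlonglongrightarrow> max (ev X L f) (ev X L g)"
        unfolding ev_max[OF \<mu> f g] by (intro tendsto_max L' f g)
    qed
  qed (rule ev_cong)
  moreover have "restrict (ev X L) (cfun X) = restrict L (cfun X)"
    by (auto simp: ev_cfun)
  ultimately show ?thesis by simp
qed

text \<open>The solutions of the lifting problem without the condition on \<open>A\<close>.\<close>

definition lifts :: "'z topology \<Rightarrow> 'w topology \<Rightarrow> 'a topology \<Rightarrow> ('w \<Rightarrow> 'a) \<Rightarrow>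
    ('z \<Rightarrow> ('a \<Rightarrow> real) \<Rightarrow> real) \<Rightarrow> ('z \<Rightarrow> ('w \<Rightarrow> real) \<Rightarrow> real) \<Rightarrow> bool"
  where "lifts Z W X p \<psi> \<Phi> \<longleftrightarrow> continuous_map Z (idem_space W) \<Phi> \<and>
    (\<forall>z\<in>topspace Z. idem_map W X p (\<Phi> z) = \<psi> z)"

lemma lifts_in_idem_measures: "lifts Z W X p \<psi> \<Phi> \<Longrightarrow> z \<in> topspace Z \<Longrightarrow> \<Phi> z \<in> idem_measures W"
  by (simp add: lifts_def continuous_map_idem_space)

lemma lifts_continuous:
  "lifts Z W X p \<psi> \<Phi> \<Longrightarrow> f \<in> cfun W \<Longrightarrow> continuous_map Z euclideanreal (\<lambda>z. \<Phi> z f)"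
  by (simp add: lifts_def continuous_map_idem_space)

lemma lifts_marginal:
  assumes "lifts Z W X p \<psi> \<Phi>" "z \<in> topspace Z" "g \<in> cfun X"
  shows "\<Phi> z (restrict (g \<circ> p) (topspace W)) = \<psi> z g"
proof -
  have "idem_map W X p (\<Phi> z) g = \<psi> z g" using assms by (simp add: lifts_def)
  then show ?thesis using assms(3) by (simp add: idem_map_def)
qed

lemma liftsI:
  assumes p: "continuous_map W X p" and \<psi>: "continuous_map Z (idem_space X) \<psi>"
    and "\<And>z. z \<in> topspace Z \<Longrightarrow> \<Phi> z \<in> idem_measures W"
    and "\<And>f. f \<in> cfun W \<Longrightarrow> continuous_map Z euclideanreal (\<lambda>z. \<Phi> z f)"
    and "\<And>z g. z \<in> topspace Z \<Longrightarrow> g \<in> cfun X \<Longrightarrow> \<Phi> z (restrict (g \<circ> p) (topspace W)) = \<psi> z g"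
  shows "lifts Z W X p \<psi> \<Phi>"
  unfolding lifts_def
proof (intro conjI ballI)
  show "continuous_map Z (idem_space W) \<Phi>"
    using assms by (auto simp: continuous_map_idem_space)
  fix z assume z: "z \<in> topspace Z"
  show "idem_map W X p (\<Phi> z) = \<psi> z"
  proof (rule idem_measures_eqI)
    show "\<psi> z \<in> idem_measures X" using \<psi> z by (simp add: continuous_map_idem_space)
    show "idem_map W X p (\<Phi> z) \<in> idem_measures X"
      by (rule idem_map_in_idem_measures[OF assms(3)[OF z] p])
  qed (use assms(5) z in \<open>auto simp: idem_map_def\<close>)
qed

lemma comp_in_cfun: "continuous_map W X p \<Longrightarrow> g \<in> cfun X \<Longrightarrow> restrict (g \<circ> p) (topspace W) \<in> cfun W"
  by (intro restrict_in_cfun continuous_map_compose cfun_continuous)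

lemma idem_measure_bound:
  assumes \<mu>: "\<mu> \<in> idem_measures X" and f: "f \<in> cfun X" and "\<And>x. x \<in> topspace X \<Longrightarrow> \<bar>f x\<bar> \<le> B"
  shows "\<bar>\<mu> f\<bar> \<le> B"
  using ev_nonexpansive[OF \<mu> cfun_continuous[OF f], of "\<lambda>x. 0" B] assms(3) ev_const[OF \<mu>, of 0]
  by (simp add: ev_cfun[OF f])

text \<open>The blend \<open>\<Psi>\<close> equals \<open>\<Phi>'\<close> on \<open>A\<close>, and equals \<open>\<Phi>\<close> where \<open>\<Phi>\<close> and \<open>\<Phi>'\<close> are not close. All
  of this refers to the test functions in \<open>G\<close>: these are bounded by some \<open>B\<close>, so that
  a weight of \<open>- 2 B\<close> already removes a measure from the maximum.\<close>

lemma ex_refined_lift: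
  assumes Z: "normal_space Z" and A: "closedin Z A" and C: "compact_space W"
    and p: "continuous_map W X p" and \<psi>: "continuous_map Z (idem_space X) \<psi>"
    and \<Phi>: "lifts Z W X p \<psi> \<Phi>" and \<Phi>': "lifts Z W X p \<psi> \<Phi>'"
    and G: "finite G" "G \<subseteq> cfun W" and FG: "F \<subseteq> G"
    and close: "\<And>z f. z \<in> A \<Longrightarrow> f \<in> F \<Longrightarrow> \<bar>\<Phi>' z f - \<Phi> z f\<bar> < \<epsilon>" and "\<epsilon> > 0"
  shows "\<exists>\<Psi>. lifts Z W X p \<psi> \<Psi> \<and> (\<forall>z\<in>A. \<forall>f\<in>G. \<Psi> z f = \<Phi>' z f) \<and>
    (\<forall>z\<in>topspace Z. \<forall>f\<in>F. \<bar>\<Psi> z f - \<Phi> z f\<bar> \<le> \<epsilon>)"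
proof -
  have AZ: "A \<subseteq> topspace Z" by (rule closedin_subset[OF A])
  have F: "finite F" using G(1) FG by (rule rev_finite_subset)
  have cont: "continuous_map Z euclideanreal (\<lambda>z. \<Phi> z f)" "continuous_map Z euclideanreal (\<lambda>z. \<Phi>' z f)"
    if "f \<in> cfun W" for f
    using lifts_continuous[OF \<Phi> that] lifts_continuous[OF \<Phi>' that] by auto
  define U where "U = {z \<in> topspace Z. \<forall>f\<in>F. \<bar>\<Phi>' z f - \<Phi> z f\<bar> < \<epsilon>}"
  have "openin Z {z \<in> topspace Z. \<bar>\<Phi>' z f - \<Phi> z f\<bar> \<in> {..<\<epsilon>}}" if "f \<in> F" for f
    using that G FG
    by (intro openin_continuous_map_preimage[where Y = euclideanreal] continuous_intros cont)
      (auto simp: open_lessThan)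
  then have "openin Z (topspace Z \<inter> (\<Inter>f\<in>F. {z \<in> topspace Z. \<bar>\<Phi>' z f - \<Phi> z f\<bar> \<in> {..<\<epsilon>}}))"
    using F by (cases "F = {}") (auto intro!: openin_Int openin_Inter)
  also have "topspace Z \<inter> (\<Inter>f\<in>F. {z \<in> topspace Z. \<bar>\<Phi>' z f - \<Phi> z f\<bar> \<in> {..<\<epsilon>}}) = U"
    by (auto simp: U_def)
  finally have "closedin Z (topspace Z - U)" by blast
  moreover have "disjnt A (topspace Z - U)"
    using close AZ by (auto simp: disjnt_def U_def)
  ultimately obtain \<theta> where \<theta>: "continuous_map Z euclideanreal \<theta>" "\<theta> ` A \<subseteq> {1}"
      "\<theta> ` (topspace Z - U) \<subseteq> {-1}"
    using Urysohn_lemma_alt[OF Z A] by metis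
  have "\<exists>B\<ge>0. \<forall>f\<in>G. \<forall>w\<in>topspace W. \<bar>f w\<bar> \<le> B"
    using G
  proof (induction rule: finite_induct)
    case (insert f G)
    then obtain B where B: "B \<ge> 0" "\<forall>f\<in>G. \<forall>w\<in>topspace W. \<bar>f w\<bar> \<le> B" by auto
    have "compactin W (topspace W)" using C by (simp add: compact_space_def)
    from image_compactin[OF this cfun_continuous[of f W]] have "bounded (f ` topspace W)"
      using insert.prems by (simp add: compact_imp_bounded)
    then obtain B' where "\<forall>w\<in>topspace W. \<bar>f w\<bar> \<le> B'"
      by (auto simp: bounded_iff)
    with B show ?case
      by (intro exI[of _ "max B B'"]) (auto simp: le_max_iff_disj)
  qed auto
  then obtain B where B: "B \<ge> 0" "\<And>f w. f \<in> G \<Longrightarrow> w \<in> topspace W \<Longrightarrow> \<bar>f w\<bar> \<le> B" by blast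
  have bound: "\<bar>\<Phi> z f\<bar> \<le> B" "\<bar>\<Phi>' z f\<bar> \<le> B" if "z \<in> topspace Z" "f \<in> G" for z f
    using idem_measure_bound[OF lifts_in_idem_measures[OF \<Phi> that(1)], of f B]
      idem_measure_bound[OF lifts_in_idem_measures[OF \<Phi>' that(1)], of f B] B(2) G(2) that(2)
    by auto
  (* At every point one of the two weights vanishes. On A the first one has its full size,
     off U the second one. *)
  define \<alpha> where "\<alpha> z = 2 * B * max 0 (\<theta> z)" for z
  define \<beta> where "\<beta> z = 2 * B * max 0 (- \<theta> z)" for z
  have nonneg: "\<alpha> z \<ge> 0" "\<beta> z \<ge> 0" for z
    using B(1) by (auto simp: \<alpha>_def \<beta>_def)
  moreover have "\<alpha> z = 0 \<or> \<beta> z = 0" for z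
    by (cases "\<theta> z \<ge> 0") (auto simp: \<alpha>_def \<beta>_def)
  ultimately have min0: "min (\<alpha> z) (\<beta> z) = 0" for z
    by (metis min.absorb1 min.absorb2)
  define \<Psi> where "\<Psi> z = glue W (\<alpha> z) (\<Phi> z) (\<beta> z) (\<Phi>' z)" for z
  have \<Psi>f: "\<Psi> z f = max (\<Phi> z f - \<alpha> z) (\<Phi>' z f - \<beta> z)" if "f \<in> cfun W" for z f
    using that by (simp add: \<Psi>_def glue_def)
  have "lifts Z W X p \<psi> \<Psi>"
  proof (rule liftsI[OF p \<psi>])
    show "\<Psi> z \<in> idem_measures W" if "z \<in> topspace Z" for z
      unfolding \<Psi>_def
      by (intro glue_in_idem_measures min0 lifts_in_idem_measures[OF \<Phi> that]
          lifts_in_idem_measures[OF \<Phi>' that])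
    show "continuous_map Z euclideanreal (\<lambda>z. \<Psi> z f)" if "f \<in> cfun W" for f
      unfolding \<Psi>f[OF that] \<alpha>_def \<beta>_def
      by (intro continuous_map_real_max continuous_map_diff cont that continuous_map_real_mult
          continuous_map_minus \<theta>(1)) auto
    show "\<Psi> z (restrict (g \<circ> p) (topspace W)) = \<psi> z g" if "z \<in> topspace Z" "g \<in> cfun X" for z g
      using lifts_marginal[OF \<Phi> that] lifts_marginal[OF \<Phi>' that] min0[of z]
      by (auto simp: \<Psi>f comp_in_cfun[OF p that(2)] min_def max_def split: if_splits)
  qed
  moreover have "\<Psi> z f = \<Phi>' z f" if "z \<in> A" "f \<in> G" for z f
  proof -
    have "\<theta> z = 1" using \<theta>(2) that by auto
    then have "\<alpha> z = 2 * B" "\<beta> z = 0" by (auto simp: \<alpha>_def \<beta>_def)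
    then show ?thesis
      using bound[of z f] that AZ G(2) by (auto simp: \<Psi>f subset_iff max_def abs_le_iff)
  qed
  moreover have "\<bar>\<Psi> z f - \<Phi> z f\<bar> \<le> \<epsilon>" if z: "z \<in> topspace Z" and f: "f \<in> F" for z f
  proof (cases "z \<in> U")
    case True
    then have "\<bar>\<Phi>' z f - \<Phi> z f\<bar> < \<epsilon>" using f by (auto simp: U_def)
    moreover have "\<Psi> z f = max (\<Phi> z f - \<alpha> z) (\<Phi>' z f - \<beta> z)"
      using f FG G(2) by (intro \<Psi>f) auto
    ultimately show ?thesis
      using nonneg[of z] min0[of z] by (auto simp: min_def max_def abs_le_iff split: if_splits)
  next
    case False
    then have "\<theta> z = -1" using \<theta>(3) z by auto
    then have "\<alpha> z = 0" "\<beta> z = 2 * B" by (auto simp: \<alpha>_def \<beta>_def)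
    then have "\<Psi> z f = \<Phi> z f"
      using bound[OF z, of f] f FG G(2) by (auto simp: \<Psi>f subset_iff max_def abs_le_iff)
    then show ?thesis using \<open>\<epsilon> > 0\<close> by simp
  qed
  ultimately show ?thesis by blast
qed

text \<open>Each step corrects the previous lift on \<open>A\<close>, where the error is at most \<open>2\<^sup>-\<^sup>n\<close> on \<open>F n\<close>,
  and moves it by at most \<open>2 \<cdot> 2\<^sup>-\<^sup>n\<close> on \<open>F n\<close>, uniformly on \<open>Z\<close>.\<close>

lemma ex_lift_of_approximate_lifts:
  assumes Z: "normal_space Z" and A: "closedin Z A" and C: "compact_space W"
    and p: "continuous_map W X p" and \<psi>: "continuous_map Z (idem_space X) \<psi>"
    and \<phi>: "\<And>z. z \<in> A \<Longrightarrow> \<phi> z \<in> idem_measures W"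
    and F: "determining W F"
    and approx: "\<And>G \<epsilon>. finite G \<Longrightarrow> G \<subseteq> cfun W \<Longrightarrow> \<epsilon> > 0 \<Longrightarrow>
      \<exists>\<Phi>. lifts Z W X p \<psi> \<Phi> \<and> (\<forall>z\<in>A. \<forall>f\<in>G. \<bar>\<Phi> z f - \<phi> z f\<bar> < \<epsilon>)"
  shows "\<exists>\<Phi>. lifts Z W X p \<psi> \<Phi> \<and> (\<forall>z\<in>A. \<Phi> z = \<phi> z)"
proof -
  have AZ: "A \<subseteq> topspace Z" by (rule closedin_subset[OF A])
  have Ffin: "finite (F n)" "F n \<subseteq> cfun W" and Fmono: "mono F" for n
    using F by (auto simp: determining_def)
  define P where "P n \<Phi> \<longleftrightarrow> lifts Z W X p \<psi> \<Phi> \<and>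
    (\<forall>z\<in>A. \<forall>f\<in>F n. \<bar>\<Phi> z f - \<phi> z f\<bar> < (1 / 2) ^ n)" for n and \<Phi> :: "'a \<Rightarrow> ('b \<Rightarrow> real) \<Rightarrow> real"
  define Q where "Q n \<Phi> \<Phi>' \<longleftrightarrow>
    (\<forall>z\<in>topspace Z. \<forall>f\<in>F n. \<bar>\<Phi>' z f - \<Phi> z f\<bar> \<le> 2 * (1 / 2) ^ n)"
    for n and \<Phi> \<Phi>' :: "'a \<Rightarrow> ('b \<Rightarrow> real) \<Rightarrow> real"
  have "\<exists>\<Phi>. \<forall>n. P n (\<Phi> n) \<and> Q n (\<Phi> n) (\<Phi> (Suc n))"
  proof (rule dependent_nat_choice)
    show "\<exists>\<Phi>. P 0 \<Phi>" unfolding P_def using approx[OF Ffin, of "(1 / 2) ^ 0" 0] by simp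
    fix \<Phi> n assume \<Phi>: "P n \<Phi>"
    obtain \<Phi>' where \<Phi>': "lifts Z W X p \<psi> \<Phi>'"
      "\<forall>z\<in>A. \<forall>f\<in>F (Suc n). \<bar>\<Phi>' z f - \<phi> z f\<bar> < (1 / 2) ^ Suc n"
      using approx[OF Ffin, of "(1 / 2) ^ Suc n" "Suc n"] by auto
    have sub: "F n \<subseteq> F (Suc n)" using Fmono by (simp add: monoD)
    have "\<exists>\<Psi>. lifts Z W X p \<psi> \<Psi> \<and> (\<forall>z\<in>A. \<forall>f\<in>F (Suc n). \<Psi> z f = \<Phi>' z f) \<and>
      (\<forall>z\<in>topspace Z. \<forall>f\<in>F n. \<bar>\<Psi> z f - \<Phi> z f\<bar> \<le> 2 * (1 / 2) ^ n)"
    proof (rule ex_refined_lift[OF Z A C p \<psi> _ \<Phi>'(1) Ffin sub])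
      show "lifts Z W X p \<psi> \<Phi>" using \<Phi> by (simp add: P_def)
      fix z f assume zf: "z \<in> A" "f \<in> F n"
      then have "\<bar>\<Phi> z f - \<phi> z f\<bar> < (1 / 2) ^ n" "\<bar>\<Phi>' z f - \<phi> z f\<bar> < (1 / 2) ^ Suc n"
        using \<Phi> \<Phi>'(2) sub by (auto simp: P_def)
      moreover have "(1 / 2 :: real) ^ Suc n \<le> (1 / 2) ^ n" by simp
      ultimately show "\<bar>\<Phi>' z f - \<Phi> z f\<bar> < 2 * (1 / 2) ^ n" by linarith
    qed simp
    then obtain \<Psi> where "lifts Z W X p \<psi> \<Psi>" "\<forall>z\<in>A. \<forall>f\<in>F (Suc n). \<Psi> z f = \<Phi>' z f"
      "\<forall>z\<in>topspace Z. \<forall>f\<in>F n. \<bar>\<Psi> z f - \<Phi> z f\<bar> \<le> 2 * (1 / 2) ^ n" by blast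
    then show "\<exists>\<Psi>. P (Suc n) \<Psi> \<and> Q n \<Phi> \<Psi>"
      using \<Phi>'(2) unfolding P_def Q_def by auto
  qed
  then obtain \<Phi> where P: "\<And>n. P n (\<Phi> n)" and Q: "\<And>n. Q n (\<Phi> n) (\<Phi> (Suc n))" by blast
  have lifts: "lifts Z W X p \<psi> (\<Phi> n)" for n using P[of n] by (simp add: P_def)
  have tele: "\<bar>\<Phi> (n + j) z f - \<Phi> n z f\<bar> \<le> 4 * (1 / 2) ^ n - 4 * (1 / 2) ^ (n + j)"
    if "z \<in> topspace Z" "f \<in> F n" for z f n j
  proof (induction j)
    case (Suc j)
    have "f \<in> F (n + j)" using monoD[OF Fmono, of n "n + j"] that by auto
    then have "\<bar>\<Phi> (Suc (n + j)) z f - \<Phi> (n + j) z f\<bar> \<le> 2 * (1 / 2) ^ (n + j)"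
      using Q[of "n + j"] that(1) by (simp add: Q_def)
    moreover have "(1 / 2 :: real) ^ (n + Suc j) = (1 / 2) * (1 / 2) ^ (n + j)" by simp
    ultimately show ?case using Suc by (simp add: abs_le_iff)
  qed simp
  have cauchy: "\<exists>n0. \<forall>n\<ge>n0. \<forall>j\<ge>n0. \<forall>z\<in>topspace Z. \<bar>\<Phi> n z f - \<Phi> j z f\<bar> \<le> \<epsilon>"
    if f: "f \<in> cfun W" and "\<epsilon> > 0" for f \<epsilon>
  proof -
    have "\<exists>n. \<exists>\<delta>>0. \<forall>\<mu>\<in>idem_measures W. \<forall>\<nu>\<in>idem_measures W.
        (\<forall>g\<in>F n. \<bar>\<mu> g - \<nu> g\<bar> \<le> \<delta>) \<longrightarrow> \<bar>\<mu> f - \<nu> f\<bar> \<le> \<epsilon>"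
      using F that by (simp add: determining_def)
    then obtain k \<delta> where "\<delta> > 0" and
      k: "\<forall>\<mu>\<in>idem_measures W. \<forall>\<nu>\<in>idem_measures W.
        (\<forall>g\<in>F k. \<bar>\<mu> g - \<nu> g\<bar> \<le> \<delta>) \<longrightarrow> \<bar>\<mu> f - \<nu> f\<bar> \<le> \<epsilon>" by blast
    obtain l where l: "(1 / 2 :: real) ^ l < \<delta> / 8"
      using real_arch_pow_inv[of "\<delta> / 8" "1 / 2"] \<open>\<delta> > 0\<close> by auto
    define n0 where "n0 = max k l"
    have "(1 / 2 :: real) ^ n0 \<le> (1 / 2) ^ l" by (intro power_decreasing) (auto simp: n0_def)
    with l have n0: "8 * (1 / 2 :: real) ^ n0 \<le> \<delta>" by linarith
    have near: "\<bar>\<Phi> n z g - \<Phi> n0 z g\<bar> \<le> 4 * (1 / 2) ^ n0"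
      if "n \<ge> n0" "z \<in> topspace Z" "g \<in> F k" for n z g
    proof -
      have "g \<in> F n0" using monoD[OF Fmono, of k n0] that(3) by (auto simp: n0_def)
      from tele[OF that(2) this, of "n - n0"] that(1)
      have "\<bar>\<Phi> n z g - \<Phi> n0 z g\<bar> \<le> 4 * (1 / 2) ^ n0 - 4 * (1 / 2) ^ n" by simp
      moreover have "(1 / 2 :: real) ^ n \<ge> 0" by simp
      ultimately show ?thesis by linarith
    qed
    have "\<bar>\<Phi> n z f - \<Phi> j z f\<bar> \<le> \<epsilon>" if "n \<ge> n0" "j \<ge> n0" "z \<in> topspace Z" for n j z
    proof -
      have "\<bar>\<Phi> n z g - \<Phi> j z g\<bar> \<le> \<delta>" if "g \<in> F k" for g
        using near[OF \<open>n \<ge> n0\<close> \<open>z \<in> topspace Z\<close> that] near[OF \<open>j \<ge> n0\<close> \<open>z \<in> topspace Z\<close> that] n0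
        by linarith
      then show ?thesis
        using k lifts_in_idem_measures[OF lifts that(3)] by blast
    qed
    then show ?thesis by blast
  qed
  define L where "L z f = lim (\<lambda>n. \<Phi> n z f)" for z f
  have L: "(\<lambda>n. \<Phi> n z f) \<longlonglongrightarrow> L z f" if z: "z \<in> topspace Z" and f: "f \<in> cfun W" for z f
  proof -
    have "Cauchy (\<lambda>n. \<Phi> n z f)"
    proof (rule metric_CauchyI)
      fix e :: real assume "e > 0"
      then obtain n0 where "\<forall>n\<ge>n0. \<forall>j\<ge>n0. \<forall>z\<in>topspace Z. \<bar>\<Phi> n z f - \<Phi> j z f\<bar> \<le> e / 2"
        using cauchy[OF f, of "e / 2"] by auto
      then have "\<forall>n\<ge>n0. \<forall>j\<ge>n0. dist (\<Phi> n z f) (\<Phi> j z f) < e"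
        using z \<open>e > 0\<close> by (fastforce simp: dist_real_def)
      then show "\<exists>M. \<forall>n\<ge>M. \<forall>j\<ge>M. dist (\<Phi> n z f) (\<Phi> j z f) < e" by blast
    qed
    then show ?thesis
      unfolding L_def using Cauchy_convergent convergent_LIMSEQ_iff by blast
  qed
  define \<Psi> where "\<Psi> z = restrict (L z) (cfun W)" for z
  have \<Psi>f: "\<Psi> z f = L z f" if "f \<in> cfun W" for z f
    using that by (simp add: \<Psi>_def)
  have \<Psi>I: "\<Psi> z \<in> idem_measures W" if "z \<in> topspace Z" for z
    unfolding \<Psi>_def
    by (rule idem_measures_tendsto[OF lifts_in_idem_measures[OF lifts that] L[OF that]])
  have "lifts Z W X p \<psi> \<Psi>"
  proof (rule liftsI[OF p \<psi> \<Psi>I])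
    fix f assume f: "f \<in> cfun W"
    show "continuous_map Z euclideanreal (\<lambda>z. \<Psi> z f)"
      unfolding \<Psi>f[OF f]
    proof (rule continuous_map_realI)
      fix z and e :: real assume z: "z \<in> topspace Z" "e > 0"
      obtain n where n: "\<forall>i\<ge>n. \<forall>j\<ge>n. \<forall>z\<in>topspace Z. \<bar>\<Phi> i z f - \<Phi> j z f\<bar> \<le> e / 4"
        using cauchy[OF f, of "e / 4"] z(2) by auto
      have lim: "\<bar>\<Phi> n z f - L z f\<bar> \<le> e / 4" if "z \<in> topspace Z" for z
      proof (rule LIMSEQ_le_const2)
        show "(\<lambda>j. \<bar>\<Phi> n z f - \<Phi> j z f\<bar>) \<longlonglongrightarrow> \<bar>\<Phi> n z f - L z f\<bar>"
          by (intro tendsto_intros L that f)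
      qed (use n that in auto)
      from continuous_map_realD[OF lifts_continuous[OF lifts[of n] f] z(1), of "e / 4"] z(2)
      obtain U where U: "openin Z U" "z \<in> U" "\<forall>w\<in>U. \<bar>\<Phi> n w f - \<Phi> n z f\<bar> < e / 4" by auto
      have "\<bar>L w f - L z f\<bar> < e" if "w \<in> U" for w
      proof -
        have "w \<in> topspace Z" using that openin_subset[OF U(1)] by blast
        moreover have "\<bar>\<Phi> n w f - \<Phi> n z f\<bar> < e / 4" using U(3) that by blast
        ultimately show ?thesis using lim[OF z(1)] lim[of w] z(2) by linarith
      qed
      with U show "\<exists>U. openin Z U \<and> z \<in> U \<and> (\<forall>w\<in>U. \<bar>L w f - L z f\<bar> < e)" by blast
    qed
  next
    fix z g assume z: "z \<in> topspace Z" and g: "g \<in> cfun X"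
    have "(\<lambda>n. \<Phi> n z (restrict (g \<circ> p) (topspace W))) \<longlonglongrightarrow> \<psi> z g"
      by (simp add: lifts_marginal[OF lifts z g])
    then show "\<Psi> z (restrict (g \<circ> p) (topspace W)) = \<psi> z g"
      using L[OF z comp_in_cfun[OF p g]] LIMSEQ_unique by (auto simp: \<Psi>f comp_in_cfun[OF p g])
  qed
  moreover have "\<Psi> z = \<phi> z" if z: "z \<in> A" for z
  proof (rule idem_measures_eqI[OF \<Psi>I \<phi>[OF z]])
    show zZ: "z \<in> topspace Z" using z AZ by blast
    have agree: "\<Psi> z g = \<phi> z g" if g: "g \<in> F k" for g k
    proof -
      have "\<forall>\<^sub>F n in sequentially. norm (\<Phi> n z g - \<phi> z g) \<le> (1 / 2) ^ n"
        unfolding eventually_sequentially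
      proof (intro exI[of _ k] allI impI)
        fix n assume "k \<le> n"
        then have "g \<in> F n" using monoD[OF Fmono] g by blast
        with P[of n] z show "norm (\<Phi> n z g - \<phi> z g) \<le> (1 / 2) ^ n"
          by (auto simp: P_def less_imp_le)
      qed
      moreover have "(\<lambda>n. (1 / 2 :: real) ^ n) \<longlonglongrightarrow> 0" by (intro LIMSEQ_power_zero) simp
      ultimately have "(\<lambda>n. \<Phi> n z g - \<phi> z g) \<longlonglongrightarrow> 0" by (rule Lim_null_comparison)
      then have "(\<lambda>n. \<Phi> n z g) \<longlonglongrightarrow> \<phi> z g"
        by (simp add: LIM_zero_iff)
      moreover have gW: "g \<in> cfun W" using g Ffin(2)[of k] by blast
      ultimately have "L z g = \<phi> z g" using L[OF zZ gW] LIMSEQ_unique by blast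
      then show ?thesis by (simp add: \<Psi>f[OF gW])
    qed
    fix f assume f: "f \<in> cfun W"
    have "\<bar>\<Psi> z f - \<phi> z f\<bar> \<le> \<epsilon>" if "\<epsilon> > 0" for \<epsilon>
    proof -
      have "\<exists>n. \<exists>\<delta>>0. \<forall>\<mu>\<in>idem_measures W. \<forall>\<nu>\<in>idem_measures W.
          (\<forall>g\<in>F n. \<bar>\<mu> g - \<nu> g\<bar> \<le> \<delta>) \<longrightarrow> \<bar>\<mu> f - \<nu> f\<bar> \<le> \<epsilon>"
        using F f that by (simp add: determining_def)
      then obtain n \<delta> where "\<delta> > 0"
        and n: "\<forall>\<mu>\<in>idem_measures W. \<forall>\<nu>\<in>idem_measures W.
          (\<forall>g\<in>F n. \<bar>\<mu> g - \<nu> g\<bar> \<le> \<delta>) \<longrightarrow> \<bar>\<mu> f - \<nu> f\<bar> \<le> \<epsilon>" by blast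
      have "\<forall>g\<in>F n. \<bar>\<Psi> z g - \<phi> z g\<bar> \<le> \<delta>"
        using agree[of _ n] \<open>\<delta> > 0\<close> by simp
      then show ?thesis using n \<Psi>I[OF zZ] \<phi>[OF z] by blast
    qed
    then have "\<Psi> z f - \<phi> z f = 0" by (rule dense_eq0_I)
    then show "\<Psi> z f = \<phi> z f" by simp
  qed
  ultimately show ?thesis by blast
qed

theorem theorem6p1:
  fixes X :: "'a metric" and Y :: "'b metric"
  assumes "compact_space (mtopology_of X)" and "mspace X \<noteq> {}"
    and "compact_space (mtopology_of Y)" and "mspace Y \<noteq> {}"
  shows "soft_map TYPE('z)
    (idem_space (prod_topology (mtopology_of X) (mtopology_of Y)))
    (idem_space (mtopology_of X))
    (idem_map (prod_topology (mtopology_of X) (mtopology_of Y)) (mtopology_of X) fst)"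
  unfolding soft_map_def
proof (intro conjI allI impI)
  let ?W = "prod_topology (mtopology_of X) (mtopology_of Y)"
  show "continuous_map (idem_space ?W) (idem_space (mtopology_of X)) (idem_map ?W (mtopology_of X) fst)"
    by (intro continuous_map_idem_map continuous_map_fst)
  fix Z :: "'z topology" and A \<phi> \<psi>
  assume "paracompact_space Z \<and> Hausdorff_space Z \<and> closedin Z A \<and>
      continuous_map (subtopology Z A) (idem_space ?W) \<phi> \<and>
      continuous_map Z (idem_space (mtopology_of X)) \<psi> \<and>
      (\<forall>z\<in>A. idem_map ?W (mtopology_of X) fst (\<phi> z) = \<psi> z)"
  then have Z: "normal_space Z" and A: "closedin Z A"
    and \<phi>: "continuous_map (subtopology Z A) (idem_space ?W) \<phi>"
    and \<psi>: "continuous_map Z (idem_space (mtopology_of X)) \<psi>"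
    and comm: "\<And>z. z \<in> A \<Longrightarrow> idem_map ?W (mtopology_of X) fst (\<phi> z) = \<psi> z"
    using paracompact_Hausdorff_imp_normal_space by auto
  have C: "compact_space ?W" using assms by (simp add: compact_space_prod_topology)
  have ne: "mspace (prod_metric X Y) \<noteq> {}" using assms by auto
  obtain F where F: "determining ?W F"
    using ex_determining[of "prod_metric X Y"] C ne by auto
  have "\<exists>\<Phi>. lifts Z ?W (mtopology_of X) fst \<psi> \<Phi> \<and> (\<forall>z\<in>A. \<Phi> z = \<phi> z)"
  proof (rule ex_lift_of_approximate_lifts[OF Z A C continuous_map_fst \<psi> _ F])
    show "\<phi> z \<in> idem_measures ?W" if "z \<in> A" for z
      using \<phi> that closedin_subset[OF A] by (auto simp: continuous_map_idem_space)
    show "\<exists>\<Phi>. lifts Z ?W (mtopology_of X) fst \<psi> \<Phi> \<and> (\<forall>z\<in>A. \<forall>f\<in>G. \<bar>\<Phi> z f - \<phi> z f\<bar> < \<epsilon>)"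
      if "finite G" "G \<subseteq> cfun ?W" "\<epsilon> > 0" for G \<epsilon>
      using ex_approximate_lift[OF C assms(2,4) Z A \<phi> \<psi> comm that] by (simp add: lifts_def)
  qed
  then show "\<exists>\<Phi>. continuous_map Z (idem_space ?W) \<Phi> \<and>
      (\<forall>z\<in>topspace Z. idem_map ?W (mtopology_of X) fst (\<Phi> z) = \<psi> z) \<and> (\<forall>z\<in>A. \<Phi> z = \<phi> z)"
    by (auto simp: lifts_def)
qed

end
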